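(* Let $\mu=\mu(v)$ be a stationary solution of (VPME) such that for some positive constants $a$ and $a_2$ with $a^2\ge(112a_2+3)(4e^{12}+1)$ the following hold: (i) $|\widehat\mu(\eta)|\le\frac{e^{-12}}4e^{-a|\eta|}$ for all $\eta\in\mathbb{R}$ (in particular $\mu$ is analytic); (ii) $|\mu(v)|\le\frac{a_2}{2(1+v^4)}$ for all $v\in\mathbb{R}$; (iii) $\mu(v)\ge0$ for all $v\in\mathbb{R}$. Then $\mu$ is an unstable stationary solution of (VPME) in the weak topology.
   Context: $\mathbb{T}$ is the one-dimensional torus, identified with $[-\frac12,\frac12)$ with periodic boundary conditions (length $1$). (VPME) is the system for $f=f(t,x,v)$, $(x,v)\in\mathbb{T}\times\mathbb{R}$: $$\partial_tf+v\,\partial_xf+E\,\partial_vf=0,\quad E=-\partial_xU,\quad \partial_{xx}^2U=e^U-\rho,\quad \rho(t,x)=\int_{\mathbb{R}}f(t,x,v)\,dv.$$ Solutions are weak solutions (in the sense of distributions). $\widehat\mu(\eta)=\int_{\mathbb{R}}\mu(v)e^{-i\eta v}\,dv$. The weak topology is the one of convergence against test functions $\varphi\in C_c^0(\mathbb{T}\times\mathbb{R})$: $g_n\to g$ weakly if $\int\varphi g_n\,dx\,dv\to\int\varphi g\,dx\,dv$ for all such $\varphi$. A stationary solution $\mu$ is unstable in the weak topology if there is a weak neighbourhood $\mathcal N$ of $\mu$ such that for every weak neighbourhood $\mathcal N'$ of $\mu$ there exist $T>0$ and a non-negative weak solution $f$ of (VPME) on $[0,T]$ with $f(0)\in\mathcal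 N'$ and $f(T)\notin\mathcal N$. *)

theory Defs
  imports "HOL-Analysis.Analysis"
begin

text \<open>
  Functions on the torus are 1-periodic functions on the real line, integrated over the
  fundamental domain below. Points of phase space are pairs \<open>(x, v)\<close>.
\<close>

definition torus :: "real set" where
  "torus = {-1/2..<1/2}"

text \<open>
  \<open>C\<^sup>\<infinity>\<close> functions, as the greatest class of everywhere differentiable functions that is closed
  under directional derivatives: in finite dimension this says that all iterated partial
  derivatives exist and are continuous.
\<close>

coinductive smooth :: "('a::euclidean_space \<Rightarrow> real) \<Rightarrow> bool" where
  "(\<And>x. (\<phi> has_derivative D x) (at x)) \<Longrightarrow> (\<And>h. smooth (\<lambda>x. D x h)) \<Longrightarrow> smooth \<phi>"


subsection \<open>The weak topology\<close>

definition phase_L1 :: "(real \<times> real \<Rightarrow> real) set" where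
  "phase_L1 = {g. (\<forall>x v. g (x + 1, v) = g (x, v)) \<and> set_integrable lborel (torus \<times> UNIV) g}"

definition Cc_phase :: "(real \<times> real \<Rightarrow> real) set" where
  "Cc_phase = {\<phi>. continuous_on UNIV \<phi> \<and> (\<forall>x v. \<phi> (x + 1, v) = \<phi> (x, v)) \<and>
     (\<exists>R. \<forall>x v. \<bar>v\<bar> > R \<longrightarrow> \<phi> (x, v) = 0)}"

definition pairing :: "(real \<times> real \<Rightarrow> real) \<Rightarrow> (real \<times> real \<Rightarrow> real) \<Rightarrow> real" where
  "pairing \<phi> g = (LINT z:torus \<times> UNIV|lborel. \<phi> z * g z)"

text \<open>
  The coarsest topology for which all pairings with test functions are continuous. Functions that
  agree almost everywhere are topologically indistinguishable.
\<close>

definition weak_topology :: "(real \<times> real \<Rightarrow> real) topology" where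
  "weak_topology = topology_generated_by
     {{g \<in> phase_L1. pairing \<phi> g \<in> W} | \<phi> W. \<phi> \<in> Cc_phase \<and> open W}"

definition weak_neighbourhood ::
  "(real \<times> real \<Rightarrow> real) \<Rightarrow> (real \<times> real \<Rightarrow> real) set \<Rightarrow> bool" where
  "weak_neighbourhood g N \<longleftrightarrow> (\<exists>S. openin weak_topology S \<and> g \<in> S \<and> S \<subseteq> N)"


subsection \<open>Weak solutions of (VPME)\<close>

text \<open>
  Test functions on \<open>(0,T) \<times> \<T>\<close> and on \<open>(0,T) \<times> \<T> \<times> \<real>\<close>, extended by zero in \<open>t\<close>.
\<close>

definition test_tx :: "real \<Rightarrow> (real \<times> real \<Rightarrow> real) set" where
  "test_tx T = {\<phi>. smooth \<phi> \<and> (\<forall>t x. \<phi> (t, x + 1) = \<phi> (t, x)) \<and>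
     (\<exists>a b. 0 < a \<and> b < T \<and> (\<forall>t x. \<phi> (t, x) \<noteq> 0 \<longrightarrow> a \<le> t \<and> t \<le> b))}"

definition test_txv :: "real \<Rightarrow> (real \<times> real \<times> real \<Rightarrow> real) set" where
  "test_txv T = {\<phi>. smooth \<phi> \<and> (\<forall>t x v. \<phi> (t, x + 1, v) = \<phi> (t, x, v)) \<and>
     (\<exists>a b R. 0 < a \<and> b < T \<and>
        (\<forall>t x v. \<phi> (t, x, v) \<noteq> 0 \<longrightarrow> a \<le> t \<and> t \<le> b \<and> \<bar>v\<bar> \<le> R))}"

definition density :: "(real \<Rightarrow> real \<times> real \<Rightarrow> real) \<Rightarrow> real \<Rightarrow> real \<Rightarrow> real" where
  "density f t x = (LINT v|lborel. f t (x, v))"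

text \<open>
  \<open>E = -\<partial>\<^sub>xU\<close> and \<open>\<partial>\<^sub>x\<^sub>xU = e\<^sup>U - \<rho>\<close> in the sense of distributions on \<open>(0,T) \<times> \<T>\<close>.
\<close>

definition poisson_weak ::
  "real \<Rightarrow> (real \<Rightarrow> real \<Rightarrow> real) \<Rightarrow> (real \<Rightarrow> real \<Rightarrow> real) \<Rightarrow> (real \<Rightarrow> real \<Rightarrow> real) \<Rightarrow> bool" where
  "poisson_weak T \<rho> U E \<longleftrightarrow>
     (\<forall>t x. U t (x + 1) = U t x) \<and> (\<forall>t x. E t (x + 1) = E t x) \<and>
     set_integrable lborel ({0<..<T} \<times> torus) (\<lambda>(t, x). U t x) \<and>
     set_integrable lborel ({0<..<T} \<times> torus) (\<lambda>(t, x). exp (U t x)) \<and>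
     set_integrable lborel ({0<..<T} \<times> torus) (\<lambda>(t, x). E t x) \<and>
     (\<forall>\<phi> \<in> test_tx T.
        set_lebesgue_integral lborel ({0<..<T} \<times> torus)
          (\<lambda>(t, x). E t x * \<phi> (t, x)) =
        set_lebesgue_integral lborel ({0<..<T} \<times> torus)
          (\<lambda>(t, x). U t x * deriv (\<lambda>y. \<phi> (t, y)) x)) \<and>
     (\<forall>\<phi> \<in> test_tx T.
        set_lebesgue_integral lborel ({0<..<T} \<times> torus)
          (\<lambda>(t, x). U t x * deriv (deriv (\<lambda>y. \<phi> (t, y))) x) =
        set_lebesgue_integral lborel ({0<..<T} \<times> torus)
          (\<lambda>(t, x). (exp (U t x) - \<rho> t x) * \<phi> (t, x)))"

definition vlasov_weak ::
  "real \<Rightarrow> (real \<Rightarrow> real \<times> real \<Rightarrow> real) \<Rightarrow> (real \<Rightarrow> real \<Rightarrow> real) \<Rightarrow> bool" where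
  "vlasov_weak T f E \<longleftrightarrow>
     set_integrable lborel ({0<..<T} \<times> torus \<times> UNIV) (\<lambda>(t, x, v). f t (x, v)) \<and>
     set_integrable lborel ({0<..<T} \<times> torus \<times> UNIV) (\<lambda>(t, x, v). E t x * f t (x, v)) \<and>
     (\<forall>\<phi> \<in> test_txv T.
        set_lebesgue_integral lborel ({0<..<T} \<times> torus \<times> UNIV)
          (\<lambda>(t, x, v). f t (x, v) *
             (deriv (\<lambda>s. \<phi> (s, x, v)) t + v * deriv (\<lambda>y. \<phi> (t, y, v)) x
               + E t x * deriv (\<lambda>w. \<phi> (t, x, w)) v)) = 0)"

text \<open>
  Weak solutions on \<open>[0,T]\<close> of class \<open>L\<^sup>\<infinity>(0,T; L\<^sup>1(\<T> \<times> \<real>))\<close>. Continuity in time for the weak topology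
  gives a meaning to the values at the end points. Since \<open>E\<close> is independent of \<open>v\<close>, the term
  \<open>E \<partial>\<^sub>vf\<close> is \<open>\<partial>\<^sub>v(E f)\<close>.
\<close>

definition vpme_weak_solution :: "real \<Rightarrow> (real \<Rightarrow> real \<times> real \<Rightarrow> real) \<Rightarrow> bool" where
  "vpme_weak_solution T f \<longleftrightarrow>
     continuous_map (top_of_set {0..T}) weak_topology f \<and>
     (\<exists>C. \<forall>t\<in>{0..T}. (LINT z:torus \<times> UNIV|lborel. \<bar>f t z\<bar>) \<le> C) \<and>
     (\<exists>U E. poisson_weak T (density f) U E \<and> vlasov_weak T f E)"


subsection \<open>Stationary solutions and instability\<close>

definition vpme_stationary :: "(real \<times> real \<Rightarrow> real) \<Rightarrow> bool" where
  "vpme_stationary g \<longleftrightarrow> (\<forall>T>0. vpme_weak_solution T (\<lambda>t. g))"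

definition vpme_weakly_unstable :: "(real \<times> real \<Rightarrow> real) \<Rightarrow> bool" where
  "vpme_weakly_unstable g \<longleftrightarrow> vpme_stationary g \<and>
     (\<exists>N. weak_neighbourhood g N \<and>
        (\<forall>N'. weak_neighbourhood g N' \<longrightarrow>
           (\<exists>T f. T > 0 \<and> vpme_weak_solution T f \<and> (\<forall>t\<in>{0..T}. \<forall>z. 0 \<le> f t z) \<and>
              f 0 \<in> N' \<and> f T \<notin> N)))"

definition fourier :: "(real \<Rightarrow> real) \<Rightarrow> real \<Rightarrow> complex" where
  "fourier \<mu> \<eta> = (LINT v|lborel. complex_of_real (\<mu> v) * exp (- (\<i> * complex_of_real (\<eta> * v))))"

end

theory Submission
  imports Defs "HOL-Complex_Analysis.Complex_Analysis" "HOL-Probability.Sinc_Integral"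
begin

text \<open>
  The instability is produced by exact solutions whose electric field vanishes identically. If
  \<open>\<integral> \<kappa>(v) e\<^sup>i\<^sup>s\<^sup>v dv = 0\<close> for all \<open>s \<ge> 0\<close>, then the freely transported function
  \<open>f(t,x,v) = F(v) + Re (\<kappa>(v) exp (2\<pi>i (x + (T - t) v)))\<close> has a density that is constant in \<open>x\<close> and
  in \<open>t \<in> [0,T]\<close>, so it solves (VPME) with constant \<open>U\<close>. On any bounded velocity interval
  \<open>\<mu>\<close> is an \<open>L\<^sup>1\<close>-limit of such \<open>\<kappa>\<close>, namely of \<open>P(v) (1 - i c v)\<^sup>-\<^sup>d\<close> with a polynomial \<open>P\<close> close to
  \<open>\<mu>\<close> and a small \<open>c > 0\<close>. With \<open>F = \<mu> + |\<kappa> - \<mu>|\<close> the solution is nonnegative, and the possibly huge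
  mass at large velocities is invisible to compactly supported test functions. Initially the solution
  is close to \<open>\<mu>(v) (1 + cos (2\<pi> (x + T v)))\<close>, which tends weakly to \<open>\<mu>\<close> as \<open>T\<close> grows; at time \<open>T\<close> it
  is close to \<open>\<mu>(v) (1 + cos (2\<pi> x))\<close>, which stays away from \<open>\<mu>\<close> because \<open>\<mu>\<close> has positive mass.
\<close>

subsection \<open>Integrable functions with one-sided spectrum\<close>

text \<open>The spectral condition is one-sided because the density at time t samples the transform
  of \<kappa> at 2 \<pi> (T - t), which is nonnegative exactly for t \<le> T. A condition on the
  whole line would force \<kappa> = 0 almost everywhere; a half-line condition makes \<kappa> the
  boundary value of a function of Hardy type on the upper half-plane. Such boundary values are rigid
  globally but flexible on bounded intervals, where they can imitate a nonnegative \<mu> at the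
  price of uncontrolled size elsewhere. The factor (1 - i c v)^(-d) has its only pole at -i/c, below
  the real axis; it supplies the decay that a polynomial lacks and tends to 1 on bounded sets as c
  tends to 0. The correction |\<kappa> - \<mu>| does not depend on x, so it shifts the density by a
  constant only, and it gives F \<ge> |\<kappa>|. The potential U is the logarithm of the mass of F.
  Positive mass of \<mu> thus enters both the field-free solution and the gap at time T; it is
  extracted from stationarity, since e^U - \<rho> must have zero mean while e^U > 0.\<close>

lemma integral_real_axis_eq_0:
  fixes f :: "complex \<Rightarrow> complex"
  assumes \<delta>: "0 < \<delta>" and hol: "f holomorphic_on {z. - \<delta> < Im z}"
    and decay: "\<And>z. 0 \<le> Im z \<Longrightarrow> r\<^sub>0 \<le> cmod z \<Longrightarrow> cmod (f z) \<le> C / cmod z ^ 2"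
    and int: "integrable lborel (\<lambda>x. f (of_real x))"
  shows "(LINT x|lborel. f (of_real x)) = 0"
proof -
  let ?I = "\<lambda>n. LINT x|lborel. indicator {- real n..real n} x *\<^sub>R f (of_real x)"
  have lim: "?I \<longlonglongrightarrow> (LINT x|lborel. f (of_real x))"
  proof (rule integral_dominated_convergence[where w = "\<lambda>x. norm (f (of_real x))"])
    show "AE x in lborel. (\<lambda>i. indicat_real {- real i..real i} x *\<^sub>R f (of_real x)) \<longlonglongrightarrow> f (of_real x)"
    proof (intro AE_I2 tendsto_eventually)
      fix x :: real
      show "\<forall>\<^sub>F i in sequentially. indicat_real {- real i..real i} x *\<^sub>R f (of_real x) = f (of_real x)"
        using eventually_ge_at_top[of "nat \<lceil>\<bar>x\<bar>\<rceil>"]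
        by eventually_elim (auto simp: indicator_def abs_le_iff nat_le_iff ceiling_le_iff)
    qed
  qed (use int in \<open>auto simp: indicator_def\<close>)
  \<comment> \<open>Close the segment [-n, n] by the upper semicircle of radius n. The margin
    \<delta> keeps this contour inside an open convex half-plane, where Cauchy's theorem applies; on
    an arc of length n \<pi> the bound C / n^2 leaves C \<pi> / n.\<close>
  have bound: "norm (?I n) \<le> (C * pi) * inverse (real n)" if n: "0 < n" "r\<^sub>0 \<le> real n" for n
  proof -
    let ?r = "real n"
    let ?H = "{z. - \<delta> < Im z}"
    have conv: "convex ?H" and opn: "open ?H"
      using convex_halfspace_Im_gt open_halfspace_Im_gt by auto
    have arc: "path_image (part_circlepath 0 ?r 0 pi) \<subseteq> {z. 0 \<le> Im z \<and> cmod z = ?r}"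
      by (auto simp: path_image_part_circlepath' norm_mult sin_ge_zero closed_segment_eq_real_ivl
          intro!: mult_nonneg_nonneg)
    have seg: "closed_segment (- of_real ?r) (of_real ?r) \<subseteq> ?H"
      by (rule closed_segment_subset) (use conv \<delta> in auto)
    have i1: "f contour_integrable_on part_circlepath 0 ?r 0 pi"
      by (rule contour_integrable_holomorphic_simple[OF hol opn])
        (use arc \<delta> in auto)
    have i2: "f contour_integrable_on linepath (- of_real ?r) (of_real ?r)"
      by (rule contour_integrable_holomorphic_simple[OF hol opn]) (use seg in auto)
    have "(f has_contour_integral 0) (linepath (- of_real ?r) (of_real ?r) +++ part_circlepath 0 ?r 0 pi)"
      by (rule Cauchy_theorem_convex_simple[OF hol conv])
        (use arc seg \<delta> in \<open>auto simp: path_image_join exp_Euler cos_of_real sin_of_real\<close>)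
    then have "contour_integral (linepath (- of_real ?r) (of_real ?r)) f
        + contour_integral (part_circlepath 0 ?r 0 pi) f = 0"
      using contour_integral_join[OF i2 i1] contour_integral_unique by fastforce
    then have "norm (contour_integral (linepath (- of_real ?r) (of_real ?r)) f)
        = norm (contour_integral (part_circlepath 0 ?r 0 pi) f)"
      by (metis add_eq_0_iff norm_minus_cancel)
    also have "\<dots> \<le> C / ?r ^ 2 * ?r * \<bar>pi - 0\<bar>"
    proof (rule contour_integral_bound_part_circlepath[OF i1])
      show "norm (f z) \<le> C / ?r ^ 2" if "z \<in> path_image (part_circlepath 0 ?r 0 pi)" for z
        using decay[of z] that arc n by auto
      then show "0 \<le> C / ?r ^ 2"
        using norm_ge_zero order_trans pathstart_in_path_image by blast
    qed (use n in auto)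
    also have "\<dots> = (C * pi) * inverse ?r"
      using n by (simp add: field_simps power2_eq_square)
    also have "contour_integral (linepath (- of_real ?r) (of_real ?r)) f
        = integral {-?r..?r} (\<lambda>x. f (of_real x))"
      using n by (subst contour_integral_linepath_Reals_eq) auto
    also have "\<dots> = ?I n"
      using set_borel_integral_eq_integral(2)[of "{-?r..?r}" "\<lambda>x. f (of_real x)"] int
      by (simp add: set_lebesgue_integral_def set_integrable_def integrable_mult_indicator)
    finally show ?thesis .
  qed
  have "?I \<longlonglongrightarrow> 0"
  proof (rule Lim_null_comparison)
    show "\<forall>\<^sub>F n in sequentially. norm (?I n) \<le> (C * pi) * inverse (real n)"
      using eventually_gt_at_top[of 0] eventually_ge_at_top[of "nat \<lceil>r\<^sub>0\<rceil>"]
      by eventually_elim (rule bound, auto simp: nat_le_iff ceiling_le_iff)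
    show "(\<lambda>n. (C * pi) * inverse (real n)) \<longlonglongrightarrow> 0"
      using tendsto_mult_right_zero[OF lim_inverse_n] by blast
  qed
  with lim show ?thesis
    using LIMSEQ_unique by blast
qed

text \<open>The integrand extends holomorphically to the half-plane above the pole -i/c. In Im z
  \<ge> 0 the degree gap of at least 2 gives quadratic decay, and e^(isz) has modulus at most 1
  because s \<ge> 0, so the contour argument applies.\<close>

lemma one_sided_kernel:
  fixes c :: real
  assumes c: "0 < c" and d: "j + 2 \<le> d"
  shows integrable_one_sided_kernel:
      "integrable lborel (\<lambda>v::real. of_real v ^ j / (1 - \<i> * of_real (c * v)) ^ d)"
    and fourier_one_sided_kernel:
      "0 \<le> s \<Longrightarrow> (LINT v|lborel. of_real v ^ j / (1 - \<i> * of_real (c * v)) ^ d * cis (s * v)) = 0"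
proof -
  let ?k = "\<lambda>z. z ^ j / (1 - \<i> * (of_real c * z)) ^ d"
  have low: "c * cmod z \<le> cmod (1 - \<i> * (of_real c * z))" "1 \<le> cmod (1 - \<i> * (of_real c * z))"
    if "0 \<le> Im z" for z
  proof -
    have e: "cmod (1 - \<i> * (of_real c * z)) ^ 2 = (1 + c * Im z)^2 + (c * Re z)^2"
      by (simp add: cmod_power2)
    have "(c * cmod z)^2 = (c * Im z)^2 + (c * Re z)^2"
      by (simp add: power_mult_distrib cmod_power2 algebra_simps)
    also have "\<dots> \<le> cmod (1 - \<i> * (of_real c * z)) ^ 2"
      unfolding e using c that by (intro add_right_mono power_mono) auto
    finally show "c * cmod z \<le> cmod (1 - \<i> * (of_real c * z))"
      using norm_ge_zero power2_le_imp_le by blast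
    have "1 \<le> 1 + c * Im z" using c that by simp
    also have "\<dots> \<le> cmod (1 - \<i> * (of_real c * z))"
      using complex_Re_le_cmod[of "1 - \<i> * (of_real c * z)"] by simp
    finally show "1 \<le> cmod (1 - \<i> * (of_real c * z))" .
  qed
  \<comment> \<open>With |1 - i c z|^2 in the denominator one bound serves twice: on the real axis
    it is a multiple of the integrable function 1 / (1 + (c x)^2), and for large z it gives decay
    like 1 / |z|^2.\<close>
  have bd: "cmod (?k z) \<le> inverse c ^ j / cmod (1 - \<i> * (of_real c * z)) ^ 2" if "0 \<le> Im z" for z
  proof -
    let ?q = "cmod (1 - \<i> * (of_real c * z))"
    have q: "1 \<le> ?q" and q': "cmod z \<le> inverse c * ?q"
      using low[OF that] c by (auto simp: field_simps)
    have q0: "0 < ?q" using q by linarith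
    have "cmod (?k z) = cmod z ^ j / ?q ^ d"
      by (simp add: norm_divide norm_power)
    also have "\<dots> \<le> (inverse c * ?q) ^ j / ?q ^ d"
      using q q' by (intro divide_right_mono power_mono) auto
    also have "\<dots> = inverse c ^ j / (?q ^ (d - j))"
      using q d power_add[of ?q j "d - j"] by (simp add: power_mult_distrib divide_simps)
    also have "\<dots> \<le> inverse c ^ j / ?q ^ 2"
      using q d c by (intro divide_left_mono power_increasing mult_pos_pos zero_less_power q0) auto
    finally show ?thesis .
  qed
  have "integrable lborel (\<lambda>x. inverse (1 + x^2) :: real)"
    using integrable_inverse_1_plus_square by (simp add: set_integrable_def)
  then have "integrable lborel (\<lambda>x. inverse (1 + (0 + c * x)^2) :: real)"
    by (rule lborel_integrable_real_affine) (use c in simp)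
  then have "integrable lborel (\<lambda>x. inverse c ^ j * inverse (1 + (c * x)^2) :: real)"
    by simp
  then show int: "integrable lborel (\<lambda>v::real. of_real v ^ j / (1 - \<i> * of_real (c * v)) ^ d)"
  proof (rule Bochner_Integration.integrable_bound)
    show "AE x in lborel. norm ((of_real x :: complex) ^ j / (1 - \<i> * of_real (c * x)) ^ d)
        \<le> norm (inverse c ^ j * inverse (1 + (c * x)^2))"
    proof (rule AE_I2)
      fix x :: real
      have "cmod (1 - \<i> * (of_real c * of_real x)) ^ 2 = 1 + (c * x)^2"
        by (simp add: cmod_power2)
      with bd[of "of_real x"] c
      show "norm ((of_real x :: complex) ^ j / (1 - \<i> * of_real (c * x)) ^ d)
        \<le> norm (inverse c ^ j * inverse (1 + (c * x)^2))"
        by (simp add: divide_inverse abs_mult)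
    qed
  qed simp
  assume s: "0 \<le> s"
  let ?f = "\<lambda>z. ?k z * exp (\<i> * (of_real s * z))"
  \<comment> \<open>The half-plane Im z > -1/c is bounded by the line through the pole, which fixes
    \<delta>; the constant C comes from |1 - i c z| \<ge> c |z|.\<close>
  have "(LINT x|lborel. ?f (of_real x)) = 0"
  proof (rule integral_real_axis_eq_0[where \<delta> = "1 / c" and r\<^sub>0 = 1 and C = "inverse c ^ j / c ^ 2"])
    have "1 - \<i> * (of_real c * z) \<noteq> 0" if "- (1 / c) < Im z" for z
    proof
      assume "1 - \<i> * (of_real c * z) = 0"
      then have "Re (1 - \<i> * (of_real c * z)) = 0" by simp
      then have "1 + c * Im z = 0" by simp
      with that c show False by (simp add: field_simps)
    qed
    then show "?f holomorphic_on {z. - (1 / c) < Im z}"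
      by (intro holomorphic_intros) auto
    show "cmod (?f z) \<le> inverse c ^ j / c ^ 2 / cmod z ^ 2" if z: "0 \<le> Im z" "1 \<le> cmod z" for z
    proof -
      have "cmod (?f z) \<le> cmod (?k z) * 1"
        unfolding norm_mult using z s by (intro mult_left_mono) (auto simp: norm_exp_eq_Re)
      also have "\<dots> \<le> inverse c ^ j / cmod (1 - \<i> * (of_real c * z)) ^ 2"
        using bd[OF z(1)] by simp
      also have "\<dots> \<le> inverse c ^ j / (c * cmod z) ^ 2"
        using low[OF z(1)] z c by (intro divide_left_mono power_mono mult_pos_pos zero_less_power) auto
      finally show ?thesis by (simp add: power_mult_distrib)
    qed
    show "integrable lborel (\<lambda>x. ?f (of_real x))"
      by (rule Bochner_Integration.integrable_bound[OF int])
        (auto simp: norm_mult norm_divide norm_power norm_exp_eq_Re)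
  qed (use c in auto)
  then show "(LINT v|lborel. of_real v ^ j / (1 - \<i> * of_real (c * v)) ^ d * cis (s * v)) = 0"
    by (simp add: cis_conv_exp)
qed

text \<open>A measurable function is an almost everywhere limit of continuous ones; dominated
  convergence on [-R, R] turns this into L1 approximation, and Weierstrass replaces the continuous
  function by a polynomial. Each stage costs e / 2.\<close>

lemma polynomial_L1_approximation:
  fixes u :: "real \<Rightarrow> real"
  assumes u: "u \<in> borel_measurable borel" and u_bd: "\<And>x. 0 \<le> u x" "\<And>x. u x \<le> B" and e: "0 < e"
  obtains a n where
    "(LINT x|lborel. indicator {- R..R} x * \<bar>(\<Sum>i\<le>n. a i * x ^ i) - u x\<bar>) < e"
proof -
  have "u measurable_on UNIV"
    by (rule lebesgue_measurable_imp_measurable_on) (use u in \<open>auto intro: measurable_completion\<close>)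
  then obtain N g where N: "negligible N" and g: "\<And>n::nat. continuous_on UNIV (g n)"
    and lim: "\<And>x. x \<notin> N \<Longrightarrow> (\<lambda>n. g n x) \<longlonglongrightarrow> u x"
    unfolding measurable_on_def by auto
  \<comment> \<open>Clamping to [0, B] preserves the limit, since u takes its values there, and
    supplies the constant majorant for dominated convergence.\<close>
  define h where "h n x = max 0 (min B (g n x))" for n x
  have B: "0 \<le> B" using u_bd[of 0] by linarith
  have h: "continuous_on UNIV (h n)" for n
    unfolding h_def by (intro continuous_intros g)
  have h_meas [measurable]: "h n \<in> borel_measurable borel" for n
    by (rule borel_measurable_continuous_onI[OF h])
  have h_lim: "(\<lambda>n. h n x) \<longlonglongrightarrow> u x" if "x \<notin> N" for x
  proof -
    have "(\<lambda>n. h n x) \<longlonglongrightarrow> max 0 (min B (u x))"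
      unfolding h_def by (intro tendsto_intros lim that)
    then show ?thesis using u_bd[of x] by simp
  qed
  have fin: "integrable lborel (\<lambda>x. indicator {- R..R} x * c :: real)" for c
    by (intro integrable_mult_left integrable_real_indicator) (auto simp: emeasure_lborel_Icc_eq)
  have "AE x in lebesgue. x \<notin> N"
    using N by (simp add: negligible_iff_null_sets AE_not_in)
  then have AE_N: "AE x in lborel. x \<notin> N"
    by (simp add: AE_completion_iff)
  have "(\<lambda>n. LINT x|lborel. indicator {- R..R} x * \<bar>h n x - u x\<bar>) \<longlonglongrightarrow> (LINT x|(lborel :: real measure). 0)"
  proof (rule integral_dominated_convergence[where w = "\<lambda>x. indicator {- R..R} x * B"])
    show "AE x in lborel. (\<lambda>n. indicator {- R..R} x * \<bar>h n x - u x\<bar>) \<longlonglongrightarrow> 0"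
      using AE_N
    proof eventually_elim
      case (elim x)
      have "(\<lambda>n. indicator {- R..R} x * \<bar>h n x - u x\<bar>) \<longlonglongrightarrow> indicator {- R..R} x * \<bar>u x - u x\<bar>"
        by (intro tendsto_intros h_lim elim)
      then show ?case by simp
    qed
    show "AE x in lborel. norm (indicator {- R..R} x * \<bar>h n x - u x\<bar>) \<le> indicator {- R..R} x * B" for n
    proof (rule AE_I2)
      fix x :: real
      have "\<bar>h n x - u x\<bar> \<le> B"
        using u_bd[of x] B unfolding h_def by (auto simp: abs_le_iff max_def min_def)
      then show "norm (indicator {- R..R} x * \<bar>h n x - u x\<bar>) \<le> indicator {- R..R} x * B"
        by (auto simp: indicator_def)
    qed
  qed (use u fin in measurable)
  then have "(\<lambda>n. LINT x|lborel. indicator {- R..R} x * \<bar>h n x - u x\<bar>) \<longlonglongrightarrow> 0" by simp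
  then have "\<forall>\<^sub>F n in sequentially. (LINT x|lborel. indicator {- R..R} x * \<bar>h n x - u x\<bar>) < e / 2"
    using e by (intro order_tendstoD) auto
  then obtain m where m: "(LINT x|lborel. indicator {- R..R} x * \<bar>h m x - u x\<bar>) < e / 2"
    by (auto simp: eventually_sequentially)
  \<comment> \<open>The interval has length at most 2 (|R| + 1), so a uniform error \<delta> costs
    at most e / 2; the absolute value and the summand 1 keep the quotient positive for every real
    R.\<close>
  define \<delta> where "\<delta> = e / (4 * (\<bar>R\<bar> + 1))"
  have \<delta>: "0 < \<delta>" using e by (simp add: \<delta>_def)
  obtain p where p: "real_polynomial_function p" "\<And>x. x \<in> {- R..R} \<Longrightarrow> \<bar>h m x - p x\<bar> < \<delta>"
    using Stone_Weierstrass_real_polynomial_function[of "{- R..R}" "h m" \<delta>] \<delta>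
      continuous_on_subset[OF h] by auto
  then obtain a n where an: "p = (\<lambda>x. \<Sum>i\<le>n. a i * x ^ i)"
    by (auto simp: real_polynomial_function_iff_sum)
  have p_meas [measurable]: "p \<in> borel_measurable borel"
    unfolding an by measurable
  have h_u: "\<bar>h n x - u x\<bar> \<le> B" for n x
    using u_bd[of x] B unfolding h_def by (auto simp: abs_le_iff max_def min_def)
  have hu: "integrable lborel (\<lambda>x. indicator {- R..R} x * \<bar>h m x - u x\<bar>)"
    by (rule Bochner_Integration.integrable_bound[OF fin[of B]])
      (use u h_u B in \<open>auto simp: indicator_def intro!: AE_I2\<close>)
  have "(LINT x|lborel. indicator {- R..R} x * \<bar>p x - u x\<bar>)
      \<le> (LINT x|lborel. indicator {- R..R} x * \<delta> + indicator {- R..R} x * \<bar>h m x - u x\<bar>)"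
  proof (rule integral_mono')
    show "integrable lborel (\<lambda>x. indicator {- R..R} x * \<delta> + indicator {- R..R} x * \<bar>h m x - u x\<bar>)"
      by (intro Bochner_Integration.integrable_add fin hu)
    show "indicator {- R..R} x * \<bar>p x - u x\<bar> \<le> indicator {- R..R} x * \<delta> + indicator {- R..R} x * \<bar>h m x - u x\<bar>" for x
      using p(2)[of x] by (auto simp: indicator_def)
  qed (use \<delta> in auto)
  also have "\<dots> = measure lborel {- R..R} * \<delta> + (LINT x|lborel. indicator {- R..R} x * \<bar>h m x - u x\<bar>)"
    by (subst Bochner_Integration.integral_add[OF fin hu]) simp
  also have "\<dots> < e / 2 + e / 2"
  proof (intro add_le_less_mono m)
    have "measure lborel {- R..R} * \<delta> \<le> (2 * (\<bar>R\<bar> + 1)) * \<delta>"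
      using \<delta> by (intro mult_right_mono) (auto simp: measure_def emeasure_lborel_Icc_eq)
    also have "\<dots> = e / 2" unfolding \<delta>_def by (simp add: field_simps)
    finally show "measure lborel {- R..R} * \<delta> \<le> e / 2" .
  qed
  finally show ?thesis
    using that[of a n] by (simp add: an)
qed

text \<open>Dividing a polynomial of degree at most n by the power n + 2 of 1 - i c v turns each of
  its monomials into a one-sided kernel. On [-R, R] the quotient returns to the polynomial as c = 1
  / (m + 1) tends to 0; outside, the size of \<kappa> is left open.\<close>

lemma one_sided_approximation:
  fixes u :: "real \<Rightarrow> real"
  assumes u: "u \<in> borel_measurable borel" and u_bd: "\<And>x. 0 \<le> u x" "\<And>x. u x \<le> B" and e: "0 < e"
  obtains \<kappa> :: "real \<Rightarrow> complex" where "integrable lborel \<kappa>"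
    "\<And>s. 0 \<le> s \<Longrightarrow> (LINT v|lborel. \<kappa> v * cis (s * v)) = 0"
    "(LINT v|lborel. indicator {- R..R} v * cmod (\<kappa> v - of_real (u v))) < e"
proof -
  obtain a n where an: "(LINT x|lborel. indicator {- R..R} x * \<bar>(\<Sum>i\<le>n. a i * x ^ i) - u x\<bar>) < e / 2"
    using polynomial_L1_approximation[OF u u_bd, of "e / 2" R] e by auto
  define p where "p x = (\<Sum>i\<le>n. a i * x ^ i)" for x :: real
  define w where "w m v = 1 - \<i> * of_real (inverse (real (Suc m)) * v)" for m v
  define k where "k m v = (\<Sum>i\<le>n. of_real (a i) * (of_real v ^ i / w m v ^ (n + 2)))" for m v
  have k_eq: "k m v = of_real (p v) / w m v ^ (n + 2)" for m v
    by (simp add: k_def p_def sum_divide_distrib)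
  have int: "integrable lborel (\<lambda>v. of_real v ^ i / w m v ^ (n + 2))" if "i \<le> n" for i m
    unfolding w_def using that by (intro integrable_one_sided_kernel) auto
  have int_cis: "integrable lborel (\<lambda>v. of_real v ^ i / w m v ^ (n + 2) * cis (s * v))" if "i \<le> n" for i m s
  proof (rule Bochner_Integration.integrable_bound[OF int[OF that, of m]])
    have "(\<lambda>v. cis (s * v)) \<in> borel_measurable borel"
      by (intro borel_measurable_continuous_onI continuous_intros)
    then show "(\<lambda>v. of_real v ^ i / w m v ^ (n + 2) * cis (s * v)) \<in> borel_measurable lborel"
      using borel_measurable_integrable[OF int[OF that, of m]] by measurable
  qed (simp add: norm_mult norm_divide)
  have k_int: "integrable lborel (k m)" for m
    unfolding k_def by (intro Bochner_Integration.integrable_sum integrable_mult_right int) auto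
  have k_gap: "(LINT v|lborel. k m v * cis (s * v)) = 0" if s: "0 \<le> s" for m s
  proof -
    have "(LINT v|lborel. k m v * cis (s * v))
        = (LINT v|lborel. (\<Sum>i\<le>n. of_real (a i) * (of_real v ^ i / w m v ^ (n + 2) * cis (s * v))))"
      by (simp add: k_def sum_distrib_right mult.assoc)
    also have "\<dots> = (\<Sum>i\<le>n. of_real (a i) * (LINT v|lborel. of_real v ^ i / w m v ^ (n + 2) * cis (s * v)))"
      by (subst Bochner_Integration.integral_sum, rule integrable_mult_right, rule int_cis, simp)
        (simp only: integral_mult_right_zero)
    also have "\<dots> = 0"
      unfolding w_def by (intro sum.neutral ballI) (subst fourier_one_sided_kernel, use s in auto)
    finally show ?thesis .
  qed
  have p_cont: "continuous_on UNIV p"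
    unfolding p_def by (intro continuous_intros)
  have p_meas [measurable]: "p \<in> borel_measurable borel"
    by (rule borel_measurable_continuous_onI[OF p_cont])
  have k_meas [measurable]: "k m \<in> borel_measurable borel" for m
    using borel_measurable_integrable[OF k_int] by simp
  have w1: "1 \<le> cmod (w m v)" for m v
    using complex_Re_le_cmod[of "w m v"] by (simp add: w_def)
  have w0: "w m v \<noteq> 0" for m v
    using w1[of m v] by auto
  \<comment> \<open>On the real line |w| \<ge> 1, so division only shrinks; the resulting majorant 2
    |p| is uniform in m.\<close>
  have k_p: "cmod (k m v - of_real (p v)) \<le> 2 * \<bar>p v\<bar>" for m v
  proof -
    have "cmod (k m v) \<le> \<bar>p v\<bar> / 1"
      unfolding k_eq norm_divide norm_power norm_of_real using w1 w0
      by (intro divide_left_mono one_le_power) auto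
    then show ?thesis
      using norm_triangle_ineq4[of "k m v" "of_real (p v)"] by simp
  qed
  have fin: "integrable lborel (\<lambda>x. indicator {- R..R} x * (2 * \<bar>p x\<bar>))"
  proof -
    have "continuous_on {- R..R} (\<lambda>x. 2 * \<bar>p x\<bar>)"
      by (intro continuous_intros continuous_on_subset[OF p_cont]) auto
    from borel_integrable_compact[OF _ this] show ?thesis by simp
  qed
  have "(\<lambda>m. LINT v|lborel. indicator {- R..R} v * cmod (k m v - of_real (p v)))
      \<longlonglongrightarrow> (LINT v|(lborel :: real measure). 0)"
  proof (rule integral_dominated_convergence[OF _ _ fin])
    show "AE v in lborel. (\<lambda>m. indicator {- R..R} v * cmod (k m v - of_real (p v))) \<longlonglongrightarrow> 0"
    proof (rule AE_I2)
      fix v :: real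
      have "(\<lambda>m. indicator {- R..R} v * cmod (k m v - of_real (p v)))
          \<longlonglongrightarrow> indicator {- R..R} v * cmod (of_real (p v) / (1 - \<i> * of_real (0 * v)) ^ (n + 2) - of_real (p v))"
        unfolding k_eq w_def
        by (intro tendsto_intros LIMSEQ_inverse_real_of_nat) auto
      then show "(\<lambda>m. indicator {- R..R} v * cmod (k m v - of_real (p v))) \<longlonglongrightarrow> 0"
        by simp
    qed
    show "AE x in lborel. norm (indicator {- R..R} x * cmod (k m x - of_real (p x)))
        \<le> indicator {- R..R} x * (2 * \<bar>p x\<bar>)" for m
      using k_p by (auto simp: indicator_def)
  qed measurable
  then have "(\<lambda>m. LINT v|lborel. indicator {- R..R} v * cmod (k m v - of_real (p v))) \<longlonglongrightarrow> 0"
    by simp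
  then have "\<forall>\<^sub>F m in sequentially. (LINT v|lborel. indicator {- R..R} v * cmod (k m v - of_real (p v))) < e / 2"
    using e by (intro order_tendstoD) auto
  then obtain m where m: "(LINT v|lborel. indicator {- R..R} v * cmod (k m v - of_real (p v))) < e / 2"
    by (auto simp: eventually_sequentially)
  have i1: "integrable lborel (\<lambda>v. indicator {- R..R} v * cmod (k m v - of_real (p v)))"
    by (rule Bochner_Integration.integrable_bound[OF fin]) (use k_p in \<open>auto simp: indicator_def\<close>)
  have i2: "integrable lborel (\<lambda>v. indicator {- R..R} v * \<bar>p v - u v\<bar>)"
  proof (rule Bochner_Integration.integrable_bound)
    show "integrable lborel (\<lambda>v. indicator {- R..R} v * (2 * \<bar>p v\<bar>) + indicator {- R..R} v * B)"
      by (intro Bochner_Integration.integrable_add fin integrable_mult_left integrable_real_indicator)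
        (auto simp: emeasure_lborel_Icc_eq)
    show "AE x in lborel. norm (indicator {- R..R} x * \<bar>p x - u x\<bar>)
        \<le> norm (indicator {- R..R} x * (2 * \<bar>p x\<bar>) + indicator {- R..R} x * B)"
    proof (rule AE_I2)
      fix x
      have "\<bar>p x - u x\<bar> \<le> 2 * \<bar>p x\<bar> + B" "0 \<le> B"
        using u_bd[of x] by linarith+
      then show "norm (indicator {- R..R} x * \<bar>p x - u x\<bar>)
          \<le> norm (indicator {- R..R} x * (2 * \<bar>p x\<bar>) + indicator {- R..R} x * B)"
        by (auto simp: indicator_def)
    qed
  qed (use u in measurable)
  have "(LINT v|lborel. indicator {- R..R} v * cmod (k m v - of_real (u v)))
      \<le> (LINT v|lborel. indicator {- R..R} v * cmod (k m v - of_real (p v)) + indicator {- R..R} v * \<bar>p v - u v\<bar>)"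
  proof (rule integral_mono')
    show "integrable lborel (\<lambda>v. indicator {- R..R} v * cmod (k m v - of_real (p v)) + indicator {- R..R} v * \<bar>p v - u v\<bar>)"
      using i1 i2 by (rule Bochner_Integration.integrable_add)
    show "indicator {- R..R} v * cmod (k m v - of_real (u v))
        \<le> indicator {- R..R} v * cmod (k m v - of_real (p v)) + indicator {- R..R} v * \<bar>p v - u v\<bar>" for v
    proof -
      have "cmod (k m v - of_real (u v)) \<le> cmod (k m v - of_real (p v)) + cmod (of_real (p v - u v))"
        using norm_triangle_ineq[of "k m v - of_real (p v)" "of_real (p v - u v)"] by simp
      then show ?thesis by (simp add: indicator_def del: of_real_diff)
    qed
  qed auto
  also have "\<dots> < e"
    using m an Bochner_Integration.integral_add[OF i1 i2] by (simp add: p_def)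
  finally show ?thesis
    using that[of "k m"] k_int k_gap by blast
qed


subsection \<open>Integration on products and on the torus\<close>

text \<open>For an integrable function this is Fubini; otherwise the integral is 0 by the convention
  for non-integrable functions.\<close>

lemma integral_pair_eq_0_fst:
  fixes f :: "'a::euclidean_space \<times> 'b::euclidean_space \<Rightarrow> real"
  assumes "\<And>x. (LINT y|lborel. f (x, y)) = 0"
  shows "(LINT z|lborel. f z) = 0"
proof (cases "integrable lborel f")
  case True
  then have "integrable (lborel \<Otimes>\<^sub>M lborel) f" by (simp add: lborel_prod)
  then show ?thesis
    using lborel_pair.integral_fst'[of f] assms by (simp add: lborel_prod)
qed (rule not_integrable_integral_eq)

lemma integral_pair_eq_0_snd:
  fixes f :: "'a::euclidean_space \<times> 'b::euclidean_space \<Rightarrow> real"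
  assumes "\<And>y. (LINT x|lborel. f (x, y)) = 0"
  shows "(LINT z|lborel. f z) = 0"
proof (cases "integrable lborel f")
  case True
  then have "integrable (lborel \<Otimes>\<^sub>M lborel) (\<lambda>(x, y). f (x, y))" by (simp add: lborel_prod)
  then show ?thesis
    using lborel_pair.integral_snd[of "\<lambda>x y. f (x, y)"] assms by (simp add: lborel_prod)
qed (rule not_integrable_integral_eq)

lemma integrable_pair_mult:
  fixes f :: "'a::euclidean_space \<Rightarrow> real" and g :: "'b::euclidean_space \<Rightarrow> real"
  assumes f: "integrable lborel f" and g: "integrable lborel g"
  shows "integrable lborel (\<lambda>z. f (fst z) * g (snd z))"
proof -
  have [measurable]: "f \<in> borel_measurable borel" "g \<in> borel_measurable borel"
    using f g by (auto dest: borel_measurable_integrable)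
  have "integrable (lborel \<Otimes>\<^sub>M lborel) (\<lambda>z. f (fst z) * g (snd z))"
  proof (rule lborel_pair.Fubini_integrable)
    show "integrable lborel (\<lambda>x. LINT y|lborel. norm (f (fst (x, y)) * g (snd (x, y))))"
      using f by (simp add: abs_mult)
  qed (use g in auto)
  then show ?thesis by (simp add: lborel_prod)
qed

lemma integral_pair_mult:
  fixes f :: "'a::euclidean_space \<Rightarrow> real" and g :: "'b::euclidean_space \<Rightarrow> real"
  assumes f: "integrable lborel f" and g: "integrable lborel g"
  shows "(LINT z|lborel. f (fst z) * g (snd z)) = (LINT x|lborel. f x) * (LINT y|lborel. g y)"
  using lborel_pair.integral_fst'[of "\<lambda>z. f (fst z) * g (snd z)"] integrable_pair_mult[OF f g]
  by (simp add: lborel_prod)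

text \<open>Endpoints are null sets, so one statement covers the open time interval, the half-open
  period \<open>torus\<close> and half-open velocity windows.\<close>

lemma integral_FTC_interval:
  fixes G :: "real \<Rightarrow> real"
  assumes "a \<le> b" and I: "{a<..<b} \<subseteq> I" "I \<subseteq> {a..b}" "I \<in> sets borel"
    and G: "\<And>x. (G has_real_derivative g x) (at x)" and g: "continuous_on UNIV g"
  shows "(LINT x|lborel. indicator I x * g x) = G b - G a"
proof -
  have [measurable]: "g \<in> borel_measurable borel"
    by (rule borel_measurable_continuous_onI[OF g])
  have "(LINT x|lborel. indicator I x * g x) = (LINT x|lborel. g x * indicator {a..b} x)"
  proof (rule integral_cong_AE)
    show "AE x in lborel. indicator I x * g x = g x * indicator {a..b} x"
      using AE_lborel_singleton[of a] AE_lborel_singleton[of b]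
    proof eventually_elim
      case (elim x)
      then have "x \<in> I \<longleftrightarrow> x \<in> {a..b}" using I(1,2) by fastforce
      then show ?case by (simp add: indicator_def)
    qed
  qed (use I(3) in measurable)
  also have "\<dots> = G b - G a"
    by (rule integral_FTC_Icc_real) (use assms in \<open>auto simp: continuous_on_eq_continuous_at\<close>)
  finally show ?thesis .
qed

lemma torus_borel [simp, measurable]: "torus \<in> sets borel"
  by (simp add: torus_def)

lemma torus_FTC:
  fixes G :: "real \<Rightarrow> real"
  assumes "\<And>x. (G has_real_derivative g x) (at x)" "continuous_on UNIV g" "\<And>x. G (x + 1) = G x"
  shows "(LINT x|lborel. indicator torus x * g x) = 0"
proof -
  have "{- (1 / 2)<..<1 / 2} \<subseteq> torus" "torus \<subseteq> {- (1 / 2)..1 / 2}"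
    by (auto simp: torus_def)
  from integral_FTC_interval[OF _ this _ assms(1,2)] assms(3)[of "- (1 / 2)"] show ?thesis
    by simp
qed

section \<open>Partial derivatives and bounds of test functions\<close>

lemma smooth_continuous: "smooth \<phi> \<Longrightarrow> continuous_on UNIV \<phi>"
  by (erule smooth.cases)
    (auto simp: continuous_on_eq_continuous_at intro: has_derivative_continuous)

text \<open>For a coordinate vector h this yields a partial derivative; smoothness of
  \<open>\<psi>\<close> makes it continuous and allows another differentiation.\<close>

lemma smooth_directional_derivative:
  fixes \<phi> :: "'a::euclidean_space \<Rightarrow> real"
  assumes "smooth \<phi>"
  obtains \<psi> where "smooth \<psi>"
    "\<And>z s. ((\<lambda>r. \<phi> (z + r *\<^sub>R h)) has_real_derivative \<psi> (z + s *\<^sub>R h)) (at s)"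
proof -
  obtain D where D: "\<And>x. (\<phi> has_derivative D x) (at x)" "\<And>h. smooth (\<lambda>x. D x h)"
    using assms by (cases rule: smooth.cases) auto
  have "((\<lambda>r. \<phi> (z + r *\<^sub>R h)) has_real_derivative D (z + s *\<^sub>R h) h) (at s)" for z s
  proof -
    have "((\<lambda>r. z + r *\<^sub>R h) has_derivative (\<lambda>r. r *\<^sub>R h)) (at s)"
      by (auto intro!: derivative_eq_intros)
    from has_derivative_compose[OF this D(1)]
    have "((\<lambda>r. \<phi> (z + r *\<^sub>R h)) has_derivative (\<lambda>r. D (z + s *\<^sub>R h) (r *\<^sub>R h))) (at s)" .
    moreover have "(\<lambda>r. D (z + s *\<^sub>R h) (r *\<^sub>R h)) = (*) (D (z + s *\<^sub>R h) h)"
      using linear_scale[OF has_derivative_linear[OF D(1)]] by (auto simp: mult.commute)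
    ultimately show ?thesis
      by (simp add: has_field_derivative_def)
  qed
  with that D(2) show ?thesis by blast
qed

lemma Cc_phase_bounded:
  assumes "\<phi> \<in> Cc_phase"
  obtains C where "0 \<le> C" "\<And>x v. x \<in> torus \<Longrightarrow> \<bar>\<phi> (x, v)\<bar> \<le> C"
proof -
  from assms obtain R where c: "continuous_on UNIV \<phi>" and R: "\<And>x v. \<bar>v\<bar> > R \<Longrightarrow> \<phi> (x, v) = 0"
    by (auto simp: Cc_phase_def)
  have "bounded (\<phi> ` ({-1/2..1/2} \<times> {-R..R}))"
    by (intro compact_imp_bounded compact_continuous_image continuous_on_subset[OF c] compact_Times) auto
  then obtain C where C: "\<And>z. z \<in> {-1/2..1/2} \<times> {-R..R} \<Longrightarrow> \<bar>\<phi> z\<bar> \<le> C"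
    by (auto simp: bounded_iff)
  have "\<bar>\<phi> (x, v)\<bar> \<le> max 0 C" if "x \<in> torus" for x v
  proof (cases "\<bar>v\<bar> > R")
    case False
    then have "\<bar>\<phi> (x, v)\<bar> \<le> C"
      using that by (intro C) (auto simp: torus_def)
    then show ?thesis by linarith
  qed (simp add: R)
  then show ?thesis using that[of "max 0 C"] by auto
qed

text \<open>Formulated for continuous functions that vanish at large velocities, so that it applies
  to a test function and to its partial derivatives alike.\<close>

lemma test_bounded:
  fixes \<psi> :: "real \<times> real \<times> real \<Rightarrow> real"
  assumes c: "continuous_on UNIV \<psi>" and R: "\<And>t x v. \<bar>v\<bar> > R \<Longrightarrow> \<psi> (t, x, v) = 0"
  obtains C where "\<And>t x v. t \<in> {0<..<T} \<Longrightarrow> x \<in> torus \<Longrightarrow> \<bar>\<psi> (t, x, v)\<bar> \<le> C"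
proof -
  have "bounded (\<psi> ` ({0..T} \<times> {-1/2..1/2} \<times> {-R..R}))"
    by (intro compact_imp_bounded compact_continuous_image continuous_on_subset[OF c] compact_Times) auto
  then obtain C where C: "\<And>z. z \<in> {0..T} \<times> {-1/2..1/2} \<times> {-R..R} \<Longrightarrow> \<bar>\<psi> z\<bar> \<le> C"
    by (auto simp: bounded_iff)
  have "\<bar>\<psi> (t, x, v)\<bar> \<le> max 0 C" if "t \<in> {0<..<T}" "x \<in> torus" for t x v
  proof (cases "\<bar>v\<bar> > R")
    case False
    then have "\<bar>\<psi> (t, x, v)\<bar> \<le> C"
      using that by (intro C) (auto simp: torus_def)
    then show ?thesis by linarith
  qed (simp add: R)
  then show ?thesis using that by blast
qed

subsection \<open>Freely transported waves\<close>

text \<open>The phase x + (T - t) v is constant along the free trajectories x' = v and no longer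
  depends on v at t = T: the wave is prepared so that its phases realign at the final time.\<close>

definition wave :: "(real \<Rightarrow> real) \<Rightarrow> (real \<Rightarrow> complex) \<Rightarrow> real \<Rightarrow> real \<Rightarrow> real \<times> real \<Rightarrow> real" where
  "wave F \<kappa> T t = (\<lambda>(x, v). F v + Re (\<kappa> v * cis (2 * pi * (x + (T - t) * v))))"

lemma wave_bound: "\<bar>wave F \<kappa> T t (x, v)\<bar> \<le> \<bar>F v\<bar> + cmod (\<kappa> v)"
  using abs_Re_le_cmod[of "\<kappa> v * cis (2 * pi * (x + (T - t) * v))"]
  by (simp add: wave_def norm_mult)

lemma wave_periodic: "wave F \<kappa> T t (x + 1, v) = wave F \<kappa> T t (x, v)"
proof -
  have "cis (2 * pi * (x + 1 + (T - t) * v)) = cis (2 * pi * (x + (T - t) * v)) * cis (2 * pi)"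
    unfolding cis_mult by (rule arg_cong[where f = cis]) (simp add: algebra_simps)
  then have "cis (2 * pi * (x + 1 + (T - t) * v)) = cis (2 * pi * (x + (T - t) * v))"
    by simp
  then show ?thesis by (simp only: wave_def prod.case)
qed

lemma has_derivative_wave_x:
  "((\<lambda>x. wave F \<kappa> T t (x, v)) has_real_derivative
     - (2 * pi) * Im (\<kappa> v * cis (2 * pi * (x + (T - t) * v)))) (at x)"
  unfolding wave_def
  by (auto intro!: derivative_eq_intros simp: algebra_simps)

text \<open>This derivative is -v times the one in x, which is the free transport equation.\<close>

lemma has_derivative_wave_t:
  "((\<lambda>t. wave F \<kappa> T t (x, v)) has_real_derivative
     v * (2 * pi * Im (\<kappa> v * cis (2 * pi * (x + (T - t) * v))))) (at t)"
  unfolding wave_def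
  by (auto intro!: derivative_eq_intros simp: algebra_simps)

context
  fixes F :: "real \<Rightarrow> real" and \<kappa> :: "real \<Rightarrow> complex" and T :: real
  assumes F: "integrable lborel F" and \<kappa>: "integrable lborel \<kappa>" and T: "0 < T"
begin

section \<open>Measurability, common majorants and integrability of waves\<close>

lemma F_meas [measurable]: "F \<in> borel_measurable borel"
  using borel_measurable_integrable[OF F] by simp

lemma \<kappa>_meas [measurable]: "\<kappa> \<in> borel_measurable borel"
  using borel_measurable_integrable[OF \<kappa>] by simp

lemma cis_meas [measurable]: "cis \<in> borel_measurable borel"
  by (intro borel_measurable_continuous_onI continuous_intros)

lemma wave_meas: "wave F \<kappa> T t \<in> borel_measurable borel"
  unfolding wave_def borel_prod[symmetric] by measurable

lemma wave_meas_txv: "(\<lambda>(t, x, v). wave F \<kappa> T t (x, v)) \<in> borel_measurable borel"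
  unfolding wave_def borel_prod[symmetric] by measurable

text \<open>The majorant K (|F| + |\<kappa>|), constant in x over the period, dominates a wave and
  its products with bounded functions; integrability of waves in phase space is reduced to
  it.\<close>

lemma integrable_dominating_xv:
  "integrable lborel (\<lambda>z. indicator (torus \<times> UNIV) z * (K * (\<bar>F (snd z)\<bar> + cmod (\<kappa> (snd z)))) :: real)"
proof -
  have "integrable lborel (\<lambda>z. (indicator torus (fst z) :: real) * (K * (\<bar>F (snd z)\<bar> + cmod (\<kappa> (snd z)))))"
    by (intro integrable_pair_mult[where g = "\<lambda>v. K * (\<bar>F v\<bar> + cmod (\<kappa> v))"]
        integrable_real_indicator Bochner_Integration.integrable_add
        integrable_mult_right integrable_abs integrable_norm F \<kappa>)
      (auto simp: torus_def)
  then show ?thesis by (simp add: indicator_times)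
qed

lemma integrable_dominating_txv:
  "integrable lborel (\<lambda>z. indicator ({0<..<T} \<times> torus \<times> UNIV) z *
     (K * (\<bar>F (snd (snd z))\<bar> + cmod (\<kappa> (snd (snd z))))) :: real)"
proof -
  have "integrable lborel (\<lambda>z. (indicator {0<..<T} (fst z) :: real) *
      (indicator (torus \<times> UNIV) (snd z) * (K * (\<bar>F (snd (snd z))\<bar> + cmod (\<kappa> (snd (snd z)))))))"
    by (rule integrable_pair_mult[OF _ integrable_dominating_xv]) (use T in auto)
  then show ?thesis by (simp add: indicator_times mult.assoc)
qed

lemma integrable_dominated_xv:
  assumes "h \<in> borel_measurable borel"
    and "\<And>x v. x \<in> torus \<Longrightarrow> \<bar>h (x, v)\<bar> \<le> K * (\<bar>F v\<bar> + cmod (\<kappa> v))"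
  shows "set_integrable lborel (torus \<times> UNIV) h"
  unfolding set_integrable_def
proof (rule Bochner_Integration.integrable_bound[OF integrable_dominating_xv[of K]])
  show "AE z in lborel. norm (indicat_real (torus \<times> UNIV) z *\<^sub>R h z)
      \<le> norm (indicator (torus \<times> UNIV) z * (K * (\<bar>F (snd z)\<bar> + cmod (\<kappa> (snd z)))))"
    using assms(2) by (auto simp: indicator_def intro!: AE_I2 order_trans[OF _ abs_ge_self])
qed (use assms(1) borel_Times[of torus "UNIV :: real set"] in measurable)

lemma integrable_dominated_txv:
  assumes "h \<in> borel_measurable borel"
    and "\<And>t x v. t \<in> {0<..<T} \<Longrightarrow> x \<in> torus \<Longrightarrow> \<bar>h (t, x, v)\<bar> \<le> K * (\<bar>F v\<bar> + cmod (\<kappa> v))"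
  shows "set_integrable lborel ({0<..<T} \<times> torus \<times> UNIV) h"
  unfolding set_integrable_def
proof (rule Bochner_Integration.integrable_bound[OF integrable_dominating_txv[of K]])
  show "AE z in lborel. norm (indicat_real ({0<..<T} \<times> torus \<times> UNIV) z *\<^sub>R h z)
      \<le> norm (indicator ({0<..<T} \<times> torus \<times> UNIV) z * (K * (\<bar>F (snd (snd z))\<bar> + cmod (\<kappa> (snd (snd z))))))"
    using assms(2) by (auto simp: indicator_def intro!: AE_I2 order_trans[OF _ abs_ge_self])
qed (use assms(1) borel_Times[of "{0<..<T}" "torus \<times> (UNIV :: real set)"]
      borel_Times[of torus "UNIV :: real set"] in measurable)

lemma wave_phase_L1: "wave F \<kappa> T t \<in> phase_L1"
  unfolding phase_L1_def using wave_periodic wave_bound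
  by (auto intro!: integrable_dominated_xv[where K = 1] wave_meas)

lemma wave_L1_bound:
  "(LINT z:torus \<times> UNIV|lborel. \<bar>wave F \<kappa> T t z\<bar>)
     \<le> (LINT z|lborel. indicator (torus \<times> UNIV) z * (1 * (\<bar>F (snd z)\<bar> + cmod (\<kappa> (snd z)))))"
  unfolding set_lebesgue_integral_def
  by (rule integral_mono'[OF integrable_dominating_xv])
    (use wave_bound in \<open>auto simp: indicator_def\<close>)

text \<open>In a generated topology continuity is tested on the generating sets, hence on the
  real-valued pairings as functions of t. These are sequentially continuous by dominated
  convergence, as the integrand is continuous in t under a majorant free of t.\<close>

lemma wave_continuous: "continuous_map (top_of_set {0..T}) weak_topology (wave F \<kappa> T)"
  unfolding weak_topology_def
proof (rule continuous_on_generated_topo)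
  fix U assume "U \<in> {{g \<in> phase_L1. pairing \<phi> g \<in> W} |\<phi> W. \<phi> \<in> Cc_phase \<and> open W}"
  then obtain \<phi> W where U: "U = {g \<in> phase_L1. pairing \<phi> g \<in> W}" and \<phi>: "\<phi> \<in> Cc_phase" and W: "open W"
    by blast
  obtain C where C: "0 \<le> C" "\<And>x v. x \<in> torus \<Longrightarrow> \<bar>\<phi> (x, v)\<bar> \<le> C"
    using Cc_phase_bounded[OF \<phi>] by blast
  have \<phi>_meas: "\<phi> \<in> borel_measurable borel"
    using \<phi> by (auto simp: Cc_phase_def intro: borel_measurable_continuous_onI)
  have meas: "(\<lambda>z. indicat_real (torus \<times> UNIV) z *\<^sub>R (\<phi> z * wave F \<kappa> T t z)) \<in> borel_measurable lborel" for t
    using \<phi>_meas wave_meas[of t] borel_Times[of torus "UNIV :: real set"] by measurable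
  have "continuous_on {0..T} (\<lambda>t. pairing \<phi> (wave F \<kappa> T t))"
  proof (rule continuous_on_sequentiallyI)
    fix r :: "nat \<Rightarrow> real" and t assume r: "r \<longlonglongrightarrow> t"
    show "(\<lambda>n. pairing \<phi> (wave F \<kappa> T (r n))) \<longlonglongrightarrow> pairing \<phi> (wave F \<kappa> T t)"
      unfolding pairing_def set_lebesgue_integral_def
    proof (rule integral_dominated_convergence[OF meas meas integrable_dominating_xv[of C]])
      show "AE z in lborel. (\<lambda>i. indicat_real (torus \<times> UNIV) z *\<^sub>R (\<phi> z * wave F \<kappa> T (r i) z))
          \<longlonglongrightarrow> indicat_real (torus \<times> UNIV) z *\<^sub>R (\<phi> z * wave F \<kappa> T t z)"
        by (auto simp: wave_def intro!: AE_I2 tendsto_intros r)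
      show "AE z in lborel. norm (indicat_real (torus \<times> UNIV) z *\<^sub>R (\<phi> z * wave F \<kappa> T (r i) z))
          \<le> indicat_real (torus \<times> UNIV) z * (C * (\<bar>F (snd z)\<bar> + cmod (\<kappa> (snd z))))" for i
        using C wave_bound[of F \<kappa> T "r i"]
        by (auto simp: indicator_def abs_mult intro!: AE_I2 mult_mono)
    qed
  qed
  from continuous_openin_preimage_gen[OF this W]
  show "openin (top_of_set {0..T}) (wave F \<kappa> T -` U \<inter> topspace (top_of_set {0..T}))"
    using wave_phase_L1 by (auto simp: U Int_def vimage_def conj_commute)
next
  \<comment> \<open>The zero test function with W = \<open>UNIV\<close> exhibits
    \<open>phase_L1\<close> itself as a generating set, so every wave is a point of the
    space.\<close>
  have "(\<lambda>z. 0) \<in> Cc_phase" by (auto simp: Cc_phase_def)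
  then show "wave F \<kappa> T ` topspace (top_of_set {0..T})
      \<subseteq> \<Union> {{g \<in> phase_L1. pairing \<phi> g \<in> W} |\<phi> W. \<phi> \<in> Cc_phase \<and> open W}"
    using wave_phase_L1 open_UNIV by blast
qed

text \<open>The oscillating part integrates to the real part of e^(2 \<pi> i x) times the transform
  of \<kappa> at 2 \<pi> (T - t), and t \<le> T puts this frequency on the half-line where the
  transform vanishes.\<close>

lemma density_wave:
  assumes gap: "\<And>s. 0 \<le> s \<Longrightarrow> (LINT v|lborel. \<kappa> v * cis (s * v)) = 0" and t: "t \<le> T"
  shows "density (wave F \<kappa> T) t x = (LINT v|lborel. F v)"
proof -
  let ?g = "\<lambda>v. cis (2 * pi * x) * (\<kappa> v * cis (2 * pi * (T - t) * v))"
  have "integrable lborel (\<lambda>v. \<kappa> v * cis (2 * pi * (T - t) * v))"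
    by (rule Bochner_Integration.integrable_bound[OF \<kappa>]) (auto simp: norm_mult)
  then have int: "integrable lborel ?g" by (rule integrable_mult_right)
  have "density (wave F \<kappa> T) t x = (LINT v|lborel. F v + Re (?g v))"
    unfolding density_def wave_def
  proof (intro Bochner_Integration.integral_cong refl)
    fix v
    have "cis (2 * pi * (x + (T - t) * v)) = cis (2 * pi * x) * cis (2 * pi * (T - t) * v)"
      unfolding cis_mult by (rule arg_cong[where f = cis]) (simp add: algebra_simps)
    then show "(case (x, v) of (x, v) \<Rightarrow> F v + Re (\<kappa> v * cis (2 * pi * (x + (T - t) * v)))) = F v + Re (?g v)"
      by (simp only: prod.case mult_ac)
  qed
  also have "\<dots> = (LINT v|lborel. F v) + (LINT v|lborel. Re (?g v))"
    by (rule Bochner_Integration.integral_add[OF F integrable_Re[OF int]])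
  also have "(LINT v|lborel. Re (?g v)) = Re (LINT v|lborel. ?g v)"
    by (rule integral_Re[OF int])
  also have "(LINT v|lborel. ?g v) = 0"
    using gap[of "2 * pi * (T - t)"] t by simp
  finally show ?thesis by simp
qed

text \<open>A constant density admits a constant potential with exp U equal to it, and E = 0. What
  remains of the two weak equations are integrals over one period of x-derivatives of periodic
  functions.\<close>

lemma poisson_wave:
  assumes gap: "\<And>s. 0 \<le> s \<Longrightarrow> (LINT v|lborel. \<kappa> v * cis (s * v)) = 0"
    and pos: "0 < (LINT v|lborel. F v)"
  shows "poisson_weak T (density (wave F \<kappa> T)) (\<lambda>_ _. ln (LINT v|lborel. F v)) (\<lambda>_ _. 0)"
proof -
  have const: "set_integrable lborel ({0<..<T} \<times> torus) (\<lambda>(t, x). c :: real)" for c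
  proof -
    have "integrable lborel (\<lambda>z. (indicator {0<..<T} (fst z) :: real) * (indicator torus (snd z) * c))"
      by (intro integrable_pair_mult[where g = "\<lambda>x. indicator torus x * c"] integrable_mult_left
          integrable_real_indicator) (use T in \<open>auto simp: torus_def\<close>)
    then show ?thesis
      by (simp add: set_integrable_def indicator_times mult.assoc case_prod_unfold)
  qed
  have zero: "set_lebesgue_integral lborel ({0<..<T} \<times> torus) (\<lambda>(t, x). c * g (t, x)) = 0"
    if G: "\<And>t x. ((\<lambda>y. G (t, y)) has_real_derivative g (t, x)) (at x)"
      and g: "continuous_on UNIV g" and per: "\<And>t x. G (t, x + 1) = G (t, x)"
    for G g :: "real \<times> real \<Rightarrow> real" and c
    unfolding set_lebesgue_integral_def
  proof (rule integral_pair_eq_0_fst)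
    fix t
    have "(LINT x|lborel. indicator torus x * g (t, x)) = 0"
      by (rule torus_FTC[where G = "\<lambda>y. G (t, y)"])
        (use G per in \<open>auto intro!: continuous_on_compose2[OF g] continuous_intros\<close>)
    then have "(LINT x|lborel. indicator {0<..<T} t * c * (indicator torus x * g (t, x))) = 0"
      by simp
    then show "(LINT x|lborel. indicat_real ({0<..<T} \<times> torus) (t, x) *\<^sub>R (case (t, x) of (t, x) \<Rightarrow> c * g (t, x))) = 0"
      by (simp add: indicator_times mult_ac)
  qed
  have x_deriv: "\<exists>\<psi>. smooth \<psi> \<and> (\<forall>t x. ((\<lambda>y. \<phi> (t, y)) has_real_derivative \<psi> (t, x)) (at x))
      \<and> (\<forall>t x. \<psi> (t, x + 1) = \<psi> (t, x))"
    if sm: "smooth \<phi>" and per: "\<And>t x. \<phi> (t, x + 1) = \<phi> (t, x)" for \<phi> :: "real \<times> real \<Rightarrow> real"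
  proof -
    obtain \<psi> where \<psi>: "smooth \<psi>"
      "\<And>z s. ((\<lambda>r. \<phi> (z + r *\<^sub>R (0, 1))) has_real_derivative \<psi> (z + s *\<^sub>R (0, 1))) (at s)"
      using smooth_directional_derivative[OF sm, of "(0, 1)"] by blast
    have d: "((\<lambda>y. \<phi> (t, y)) has_real_derivative \<psi> (t, x)) (at x)" for t x
      using \<psi>(2)[of "(t, 0)" x] by simp
    \<comment> \<open>Periodicity passes to the derivative by differentiating the shifted function;
      the second derivative then integrates to 0 for the same reason as the first.\<close>
    have "\<psi> (t, x + 1) = \<psi> (t, x)" for t x
    proof -
      have "((\<lambda>y. \<phi> (t, y + 1)) has_real_derivative \<psi> (t, x + 1)) (at x)"
        using d[of t "x + 1"] by (simp add: DERIV_shift)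
      then show ?thesis
        unfolding per using d DERIV_unique by blast
    qed
    with \<psi>(1) d show ?thesis by blast
  qed
  show ?thesis
    unfolding poisson_weak_def
  proof (intro conjI ballI allI)
    fix \<phi> assume "\<phi> \<in> test_tx T"
    then have sm: "smooth \<phi>" and per: "\<And>t x. \<phi> (t, x + 1) = \<phi> (t, x)"
      by (auto simp: test_tx_def)
    obtain \<psi> where \<psi>: "smooth \<psi>" "\<And>t x. ((\<lambda>y. \<phi> (t, y)) has_real_derivative \<psi> (t, x)) (at x)"
      "\<And>t x. \<psi> (t, x + 1) = \<psi> (t, x)"
      using x_deriv[OF sm per] by blast
    obtain \<theta> where \<theta>: "smooth \<theta>" "\<And>t x. ((\<lambda>y. \<psi> (t, y)) has_real_derivative \<theta> (t, x)) (at x)"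
      using x_deriv[OF \<psi>(1,3)] by blast
    have d1: "deriv (\<lambda>y. \<phi> (t, y)) = (\<lambda>x. \<psi> (t, x))" for t
      using \<psi>(2) by (auto intro: DERIV_imp_deriv)
    have d2: "deriv (\<lambda>y. \<psi> (t, y)) = (\<lambda>x. \<theta> (t, x))" for t
      using \<theta>(2) by (auto intro: DERIV_imp_deriv)
    let ?U = "ln (LINT v|lborel. F v)"
    show "(LINT (t, x):{0<..<T} \<times> torus|lborel. 0 * \<phi> (t, x))
        = (LINT (t, x):{0<..<T} \<times> torus|lborel. ?U * deriv (\<lambda>y. \<phi> (t, y)) x)"
      unfolding d1 by (subst zero[OF \<psi>(2) smooth_continuous[OF \<psi>(1)] per])
        (simp add: set_lebesgue_integral_def case_prod_unfold)
    have "(LINT (t, x):{0<..<T} \<times> torus|lborel. (exp ?U - density (wave F \<kappa> T) t x) * \<phi> (t, x))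
        = (LINT z:{0<..<T} \<times> torus|lborel. 0)"
      by (intro set_lebesgue_integral_cong)
        (auto simp: density_wave[OF gap] pos borel_Times)
    then show "(LINT (t, x):{0<..<T} \<times> torus|lborel. ?U * deriv (deriv (\<lambda>y. \<phi> (t, y))) x)
        = (LINT (t, x):{0<..<T} \<times> torus|lborel. (exp ?U - density (wave F \<kappa> T) t x) * \<phi> (t, x))"
      unfolding d1 d2 by (subst zero[OF \<theta>(2) smooth_continuous[OF \<theta>(1)] \<psi>(3)])
        (simp add: set_lebesgue_integral_def case_prod_unfold)
  qed (auto intro: const)
qed

text \<open>As the wave f is transported exactly, f (\<phi>_t + v \<phi>_x) = (f \<phi>)_t + (v f
  \<phi>)_x. The first term integrates to 0 in t by compact support in (0, T), the second in x by
  periodicity.\<close>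

lemma vlasov_wave: "vlasov_weak T (wave F \<kappa> T) (\<lambda>_ _. 0)"
  unfolding vlasov_weak_def
proof (intro conjI ballI)
  let ?S = "{0<..<T} \<times> torus \<times> (UNIV :: real set)"
  let ?w = "\<lambda>(t, x, v). wave F \<kappa> T t (x, v)"
  show "set_integrable lborel ?S ?w"
    by (rule integrable_dominated_txv[where K = 1]) (use wave_meas_txv wave_bound in auto)
  show "set_integrable lborel ?S (\<lambda>(t, x, v). 0 * wave F \<kappa> T t (x, v))"
    by (rule integrable_dominated_txv[where K = 1]) (auto simp: case_prod_unfold)
  fix \<phi> assume "\<phi> \<in> test_txv T"
  then obtain a b R where sm: "smooth \<phi>" and per: "\<And>t x v. \<phi> (t, x + 1, v) = \<phi> (t, x, v)"
    and ab: "0 < a" "b < T" and supp: "\<And>t x v. \<phi> (t, x, v) \<noteq> 0 \<Longrightarrow> a \<le> t \<and> t \<le> b \<and> \<bar>v\<bar> \<le> R"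
    unfolding test_txv_def by blast
  obtain \<phi>t where \<phi>t: "smooth \<phi>t"
    "\<And>z s. ((\<lambda>r. \<phi> (z + r *\<^sub>R (1, 0, 0))) has_real_derivative \<phi>t (z + s *\<^sub>R (1, 0, 0))) (at s)"
    using smooth_directional_derivative[OF sm, of "(1, 0, 0)"] by blast
  obtain \<phi>x where \<phi>x: "smooth \<phi>x"
    "\<And>z s. ((\<lambda>r. \<phi> (z + r *\<^sub>R (0, 1, 0))) has_real_derivative \<phi>x (z + s *\<^sub>R (0, 1, 0))) (at s)"
    using smooth_directional_derivative[OF sm, of "(0, 1, 0)"] by blast
  have dt: "((\<lambda>s. \<phi> (s, x, v)) has_real_derivative \<phi>t (t, x, v)) (at t)" for t x v
    using \<phi>t(2)[of "(0, x, v)" t] by simp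
  have dx: "((\<lambda>y. \<phi> (t, y, v)) has_real_derivative \<phi>x (t, x, v)) (at x)" for t x v
    using \<phi>x(2)[of "(t, 0, v)" x] by simp
  have \<phi>0: "\<phi> (t, x, v) = 0" if "\<bar>v\<bar> > R" for t x v
    using supp[of t x v] that by linarith
  have \<phi>t0: "\<phi>t (t, x, v) = 0" if "\<bar>v\<bar> > R" for t x v
    using dt[of x v t] \<phi>0[OF that] by (simp add: DERIV_const DERIV_unique[OF _ DERIV_const])
  have \<phi>x0: "\<phi>x (t, x, v) = 0" if "\<bar>v\<bar> > R" for t x v
    using dx[of t v x] \<phi>0[OF that] by (simp add: DERIV_const DERIV_unique[OF _ DERIV_const])
  note cont = smooth_continuous[OF sm] smooth_continuous[OF \<phi>t(1)] smooth_continuous[OF \<phi>x(1)]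
  note meas [measurable] = cont[THEN borel_measurable_continuous_onI]
  obtain C1 where C1: "\<And>t x v. t \<in> {0<..<T} \<Longrightarrow> x \<in> torus \<Longrightarrow> \<bar>\<phi> (t, x, v)\<bar> \<le> C1"
    using test_bounded[OF cont(1), of R T] \<phi>0 by blast
  obtain C2 where C2: "\<And>t x v. t \<in> {0<..<T} \<Longrightarrow> x \<in> torus \<Longrightarrow> \<bar>\<phi>t (t, x, v)\<bar> \<le> C2"
    using test_bounded[OF cont(2), of R T] \<phi>t0 by blast
  obtain C3 where C3: "\<And>t x v. t \<in> {0<..<T} \<Longrightarrow> x \<in> torus \<Longrightarrow> \<bar>\<phi>x (t, x, v)\<bar> \<le> C3"
    using test_bounded[OF cont(3), of R T] \<phi>x0 by blast
  define C where "C = \<bar>C1\<bar> + \<bar>C2\<bar> + \<bar>C3\<bar>"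
  have C: "\<bar>\<phi> (t, x, v)\<bar> \<le> C" "\<bar>\<phi>t (t, x, v)\<bar> \<le> C" "\<bar>\<phi>x (t, x, v)\<bar> \<le> C"
    if "t \<in> {0<..<T}" "x \<in> torus" for t x v
    using C1[OF that, of v] C2[OF that, of v] C3[OF that, of v] unfolding C_def by linarith+
  have C0: "0 \<le> C" by (simp add: C_def)
  define q where "q = (\<lambda>(t, x, v). - (2 * pi) * Im (\<kappa> v * cis (2 * pi * (x + (T - t) * v))))"
  have q_meas: "q \<in> borel_measurable borel"
    unfolding q_def borel_prod[symmetric] by measurable
  have q_bd: "\<bar>q (t, x, v)\<bar> \<le> 2 * pi * cmod (\<kappa> v)" for t x v
    using abs_Im_le_cmod[of "\<kappa> v * cis (2 * pi * (x + (T - t) * v))"]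
    by (simp add: q_def norm_mult abs_mult)
  have [measurable]: "(\<lambda>z :: real \<times> real \<times> real. snd (snd z)) \<in> borel_measurable borel"
    by (intro borel_measurable_continuous_onI continuous_intros)
  \<comment> \<open>Since q is the x-derivative of the wave and -v q its t-derivative,
    \<open>I1\<close> is the t-derivative of wave times \<phi>, and \<open>I2\<close> the
    x-derivative of v times that product; the terms v q \<phi> cancel in the sum.\<close>
  define I1 where "I1 z = ?w z * \<phi>t z - snd (snd z) * q z * \<phi> z" for z
  define I2 where "I2 z = snd (snd z) * (?w z * \<phi>x z + q z * \<phi> z)" for z
  \<comment> \<open>The sum of the bounds for all products involved: C for the t-derivative of
    \<phi>, |R| C for v times its x-derivative, and 2 \<pi> |R| C for v q \<phi>. One constant then
    serves both integrands.\<close>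
  define K where "K = C + \<bar>R\<bar> * (1 + 2 * pi) * C"
  have prods: "\<bar>wave F \<kappa> T t (x, v) * \<phi>t (t, x, v)\<bar> \<le> C * (\<bar>F v\<bar> + cmod (\<kappa> v))"
      "\<bar>wave F \<kappa> T t (x, v) * \<phi>x (t, x, v)\<bar> \<le> C * (\<bar>F v\<bar> + cmod (\<kappa> v))"
      "\<bar>q (t, x, v) * \<phi> (t, x, v)\<bar> \<le> 2 * pi * C * (\<bar>F v\<bar> + cmod (\<kappa> v))"
    if "t \<in> {0<..<T}" "x \<in> torus" for t x v
  proof -
    show "\<bar>wave F \<kappa> T t (x, v) * \<phi>t (t, x, v)\<bar> \<le> C * (\<bar>F v\<bar> + cmod (\<kappa> v))"
      "\<bar>wave F \<kappa> T t (x, v) * \<phi>x (t, x, v)\<bar> \<le> C * (\<bar>F v\<bar> + cmod (\<kappa> v))"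
      using mult_mono[OF wave_bound C(2)[OF that]] mult_mono[OF wave_bound C(3)[OF that]]
      by (simp_all add: abs_mult mult.commute)
    have "\<bar>q (t, x, v) * \<phi> (t, x, v)\<bar> \<le> (2 * pi * (\<bar>F v\<bar> + cmod (\<kappa> v))) * C"
      unfolding abs_mult using q_bd[of t x v] C(1)[OF that]
      by (intro mult_mono) (auto intro: order_trans simp: distrib_left)
    then show "\<bar>q (t, x, v) * \<phi> (t, x, v)\<bar> \<le> 2 * pi * C * (\<bar>F v\<bar> + cmod (\<kappa> v))"
      by (simp add: mult_ac)
  qed
  have wm: "?w \<in> borel_measurable borel" by (rule wave_meas_txv)
  have I1_int: "set_integrable lborel ?S I1"
  proof (rule integrable_dominated_txv[where K = K])
    show "I1 \<in> borel_measurable borel"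
      unfolding I1_def using wm q_meas by measurable
    fix t x v assume tx: "t \<in> {0<..<T}" "x \<in> torus"
    let ?N = "\<bar>F v\<bar> + cmod (\<kappa> v)"
    show "\<bar>I1 (t, x, v)\<bar> \<le> K * ?N"
    proof (cases "\<bar>v\<bar> > R")
      case True
      then show ?thesis using \<phi>0 \<phi>t0 C0 by (simp add: I1_def K_def)
    next
      case False
      have "\<bar>v * (q (t, x, v) * \<phi> (t, x, v))\<bar> \<le> \<bar>R\<bar> * (2 * pi * C * ?N)"
        unfolding abs_mult[of v] using False prods(3)[OF tx, of v] by (intro mult_mono) auto
      then have "\<bar>I1 (t, x, v)\<bar> \<le> C * ?N + \<bar>R\<bar> * (2 * pi * C * ?N)"
        using prods(1)[OF tx, of v] unfolding I1_def by (simp add: mult.assoc)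
      also have "\<dots> \<le> C * ?N + \<bar>R\<bar> * (2 * pi * C * ?N) + \<bar>R\<bar> * C * ?N"
        using C0 by simp
      also have "\<dots> = K * ?N" by (simp add: K_def algebra_simps)
      finally show ?thesis .
    qed
  qed
  have I2_int: "set_integrable lborel ?S I2"
  proof (rule integrable_dominated_txv[where K = K])
    show "I2 \<in> borel_measurable borel"
      unfolding I2_def using wm q_meas by measurable
    fix t x v assume tx: "t \<in> {0<..<T}" "x \<in> torus"
    let ?N = "\<bar>F v\<bar> + cmod (\<kappa> v)"
    show "\<bar>I2 (t, x, v)\<bar> \<le> K * ?N"
    proof (cases "\<bar>v\<bar> > R")
      case True
      then show ?thesis using \<phi>0 \<phi>x0 C0 by (simp add: I2_def K_def)
    next
      case False
      have "\<bar>I2 (t, x, v)\<bar> \<le> \<bar>R\<bar> * (C * ?N + 2 * pi * C * ?N)"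
        unfolding I2_def snd_conv prod.case abs_mult[of v]
        using False prods(2,3)[OF tx, of v] by (intro mult_mono) (auto simp: abs_le_iff)
      also have "\<dots> \<le> \<bar>R\<bar> * (C * ?N + 2 * pi * C * ?N) + C * ?N"
        using C0 by simp
      also have "\<dots> = K * ?N" by (simp add: K_def algebra_simps)
      finally show ?thesis .
    qed
  qed
  have I1_zero: "(LINT z|lborel. indicator ?S z *\<^sub>R I1 z) = 0"
  proof (rule integral_pair_eq_0_snd)
    fix y :: "real \<times> real"
    obtain x v where y: "y = (x, v)" by (cases y)
    have "(LINT t|lborel. indicator {0<..<T} t * I1 (t, x, v))
        = wave F \<kappa> T T (x, v) * \<phi> (T, x, v) - wave F \<kappa> T 0 (x, v) * \<phi> (0, x, v)"
    proof (rule integral_FTC_interval[where G = "\<lambda>t. wave F \<kappa> T t (x, v) * \<phi> (t, x, v)"])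
      show "((\<lambda>t. wave F \<kappa> T t (x, v) * \<phi> (t, x, v)) has_real_derivative I1 (t, x, v)) (at t)" for t
        by (rule DERIV_cong[OF DERIV_mult[OF has_derivative_wave_t dt]]) (simp add: I1_def q_def)
      show "continuous_on UNIV (\<lambda>t. I1 (t, x, v))"
        unfolding I1_def q_def wave_def prod.case snd_conv
        by (intro continuous_intros continuous_on_compose2[OF cont(1)] continuous_on_compose2[OF cont(2)]) auto
    qed (use T in auto)
    also have "\<dots> = 0"
    proof -
      have "\<phi> (T, x, v) = 0" "\<phi> (0, x, v) = 0"
        using supp[of T x v] supp[of 0 x v] ab by linarith+
      then show ?thesis by simp
    qed
    finally have "(LINT t|lborel. indicator (torus \<times> UNIV) y * (indicator {0<..<T} t * I1 (t, x, v))) = 0"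
      by simp
    then show "(LINT t|lborel. indicator ?S (t, y) *\<^sub>R I1 (t, y)) = 0"
      by (simp add: y indicator_times mult_ac)
  qed
  have I2_zero: "(LINT z|lborel. indicator ?S z *\<^sub>R I2 z) = 0"
  proof (rule integral_pair_eq_0_fst, rule integral_pair_eq_0_snd)
    fix t v :: real
    have "(LINT x|lborel. indicator torus x * I2 (t, x, v)) = 0"
    proof (rule torus_FTC[where G = "\<lambda>x. v * (wave F \<kappa> T t (x, v) * \<phi> (t, x, v))"])
      show "((\<lambda>x. v * (wave F \<kappa> T t (x, v) * \<phi> (t, x, v))) has_real_derivative I2 (t, x, v)) (at x)" for x
        by (rule DERIV_cong[OF DERIV_cmult[OF DERIV_mult[OF has_derivative_wave_x dx]]]) (simp add: I2_def q_def)
      show "continuous_on UNIV (\<lambda>x. I2 (t, x, v))"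
        unfolding I2_def q_def wave_def prod.case snd_conv
        by (intro continuous_intros continuous_on_compose2[OF cont(1)] continuous_on_compose2[OF cont(3)]) auto
    qed (simp add: wave_periodic per)
    then have "(LINT x|lborel. indicator {0<..<T} t * (indicator torus x * I2 (t, x, v))) = 0"
      by simp
    then show "(LINT x|lborel. indicator ?S (t, x, v) *\<^sub>R I2 (t, x, v)) = 0"
      by (simp add: indicator_times mult_ac)
  qed
  have "(LINT (t, x, v):?S|lborel. wave F \<kappa> T t (x, v) *
      (deriv (\<lambda>s. \<phi> (s, x, v)) t + v * deriv (\<lambda>y. \<phi> (t, y, v)) x + 0 * deriv (\<lambda>w. \<phi> (t, x, w)) v))
    = (LINT z|lborel. indicator ?S z *\<^sub>R I1 z + indicator ?S z *\<^sub>R I2 z)"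
    unfolding set_lebesgue_integral_def
    by (intro Bochner_Integration.integral_cong refl)
      (auto simp: I1_def I2_def DERIV_imp_deriv[OF dt] DERIV_imp_deriv[OF dx] algebra_simps)
  also have "\<dots> = 0"
    using Bochner_Integration.integral_add[OF I1_int[unfolded set_integrable_def] I2_int[unfolded set_integrable_def]]
      I1_zero I2_zero by simp
  finally show "(LINT (t, x, v):?S|lborel. wave F \<kappa> T t (x, v) *
      (deriv (\<lambda>s. \<phi> (s, x, v)) t + v * deriv (\<lambda>y. \<phi> (t, y, v)) x + 0 * deriv (\<lambda>w. \<phi> (t, x, w)) v)) = 0" .
qed

lemma wave_weak_solution:
  assumes "\<And>s. 0 \<le> s \<Longrightarrow> (LINT v|lborel. \<kappa> v * cis (s * v)) = 0"
    and "0 < (LINT v|lborel. F v)"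
  shows "vpme_weak_solution T (wave F \<kappa> T)"
  unfolding vpme_weak_solution_def
  using wave_continuous wave_L1_bound poisson_wave[OF assms] vlasov_wave by blast

end


subsection \<open>Weak convergence\<close>

text \<open>A Riemann-Lebesgue lemma obtained from Bessel's inequality: the coefficients are square
  summable, hence tend to 0. The orthogonal functions have common squared norm r and are left
  unnormalized.\<close>

lemma bessel_tendsto_0:
  fixes e :: "nat \<Rightarrow> 'a \<Rightarrow> real"
  assumes "finite_measure M"
    and [measurable]: "g \<in> borel_measurable M" "\<And>n. e n \<in> borel_measurable M"
    and g: "\<And>x. x \<in> space M \<Longrightarrow> \<bar>g x\<bar> \<le> B" and e: "\<And>n x. \<bar>e n x\<bar> \<le> 1"
    and orth: "\<And>n m. (LINT x|M. e n x * e m x) = (if n = m then r else 0)" and r: "0 < r"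
  shows "(\<lambda>n. LINT x|M. g x * e n x) \<longlonglongrightarrow> 0"
proof -
  interpret finite_measure M by fact
  define c where "c n = (LINT x|M. g x * e n x)" for n
  have ge: "integrable M (\<lambda>x. g x * e n x)" for n
  proof (rule integrable_const_bound[where B = B])
    show "AE x in M. norm (g x * e n x) \<le> B"
      using order_trans[OF mult_left_le[OF e abs_ge_zero] g] by (auto simp: abs_mult intro!: AE_I2)
  qed measurable
  have ee: "integrable M (\<lambda>x. e n x * e m x)" for n m
    by (rule integrable_const_bound[where B = 1])
      (auto simp: abs_mult intro!: AE_I2 mult_le_one e)
  have gg: "integrable M (\<lambda>x. g x * g x)"
  proof (rule integrable_const_bound[where B = "B * B"], rule AE_I2)
    fix x assume "x \<in> space M"
    from g[OF this] show "norm (g x * g x) \<le> B * B"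
      unfolding real_norm_def abs_mult by (intro mult_mono) auto
  qed measurable
  have "(\<Sum>n<N. c n ^ 2) \<le> r * (LINT x|M. g x * g x)" for N
  proof -
    \<comment> \<open>The orthogonal projection of g onto the span of the first N functions;
      expanding the nonnegative integral of (g - S)^2 gives Bessel's inequality.\<close>
    define S where "S x = (\<Sum>n<N. c n / r * e n x)" for x
    have gS: "g x * S x = (\<Sum>n<N. c n / r * (g x * e n x))" for x
      by (simp add: S_def sum_distrib_left algebra_simps)
    have SS: "S x * S x = (\<Sum>n<N. \<Sum>m<N. c n / r * (c m / r) * (e n x * e m x))" for x
      by (simp add: S_def sum_product algebra_simps)
    have i1: "integrable M (\<lambda>x. g x * S x)"
      unfolding gS by (intro Bochner_Integration.integrable_sum integrable_mult_right ge)
    have i2: "integrable M (\<lambda>x. S x * S x)"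
      unfolding SS by (intro Bochner_Integration.integrable_sum integrable_mult_right ee)
    have v1: "(LINT x|M. g x * S x) = (\<Sum>n<N. c n ^ 2) / r"
      unfolding gS
      by (subst Bochner_Integration.integral_sum)
        (auto intro!: integrable_mult_right ge simp: c_def[symmetric] sum_divide_distrib power2_eq_square)
    have "(LINT x|M. S x * S x) = (\<Sum>n<N. \<Sum>m<N. c n / r * (c m / r) * (LINT x|M. e n x * e m x))"
      unfolding SS
      by (subst Bochner_Integration.integral_sum, (intro Bochner_Integration.integrable_sum integrable_mult_right ee)[1],
          subst Bochner_Integration.integral_sum, (intro integrable_mult_right ee)[1],
          simp only: integral_mult_right_zero)
    also have "\<dots> = (\<Sum>n<N. \<Sum>m<N. if n = m then c n ^ 2 / r else 0)"
      using r by (intro sum.cong refl) (auto simp: orth power2_eq_square)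
    also have "\<dots> = (\<Sum>n<N. c n ^ 2) / r"
      by (simp add: sum_divide_distrib)
    finally have v2: "(LINT x|M. S x * S x) = (\<Sum>n<N. c n ^ 2) / r" .
    have "0 \<le> (LINT x|M. (g x - S x) ^ 2)"
      by (rule integral_nonneg_AE) simp
    also have "\<dots> = (LINT x|M. (g x * g x - 2 * (g x * S x)) + S x * S x)"
      by (simp add: power2_eq_square algebra_simps)
    also have "\<dots> = (LINT x|M. g x * g x) - 2 * (LINT x|M. g x * S x) + (LINT x|M. S x * S x)"
      by (simp add: gg i1 i2)
    also have "\<dots> = (LINT x|M. g x * g x) - (\<Sum>n<N. c n ^ 2) / r"
      by (simp add: v1 v2)
    finally show ?thesis using r by (simp add: field_simps)
  qed
  then have "summable (\<lambda>n. c n ^ 2)"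
    by (intro summableI_nonneg_bounded) auto
  then have "(\<lambda>n. c n ^ 2) \<longlonglongrightarrow> 0"
    by (rule summable_LIMSEQ_zero)
  then have "(\<lambda>n. sqrt (c n ^ 2)) \<longlonglongrightarrow> sqrt 0"
    by (rule tendsto_real_sqrt)
  then show ?thesis
    by (simp add: tendsto_rabs_zero_iff c_def)
qed

lemma integral_torus_cos: "k \<noteq> 0 \<Longrightarrow> (LINT x|lborel. indicator torus x * cos (2 * pi * (real_of_int k * x + c))) = 0"
proof (rule torus_FTC)
  assume k: "k \<noteq> 0"
  let ?G = "\<lambda>x. sin (2 * pi * (real_of_int k * x + c)) / (2 * pi * k)"
  show "(?G has_real_derivative cos (2 * pi * (real_of_int k * x + c))) (at x)" for x
    using k by (auto intro!: derivative_eq_intros)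
  show "continuous_on UNIV (\<lambda>x. cos (2 * pi * (real_of_int k * x + c)))"
    by (intro continuous_intros)
  show "?G (x + 1) = ?G x" for x
  proof -
    have "sin (2 * pi * (real_of_int k * (x + 1) + c)) = sin (2 * pi * (real_of_int k * x + c) + 2 * pi * of_int k)"
      by (simp add: algebra_simps)
    then show ?thesis by (simp add: sin_add)
  qed
qed

text \<open>An integer L makes the window a union of full periods, so the primitive vanishes at both
  ends.\<close>

lemma integral_interval_cos:
  fixes L :: nat
  assumes "k \<noteq> 0"
  shows "(LINT v|lborel. indicator {- real L..<real L} v * cos (2 * pi * (real_of_int k * v))) = 0"
proof -
  let ?G = "\<lambda>v. sin (2 * pi * (real_of_int k * v)) / (2 * pi * k)"
  have "(LINT v|lborel. indicator {- real L..<real L} v * cos (2 * pi * (real_of_int k * v))) = ?G (real L) - ?G (- real L)"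
  proof (rule integral_FTC_interval[where G = ?G])
    show "(?G has_real_derivative cos (2 * pi * (real_of_int k * v))) (at v)" for v
      using assms by (auto intro!: derivative_eq_intros)
    show "continuous_on UNIV (\<lambda>v. cos (2 * pi * (real_of_int k * v)))"
      by (intro continuous_intros)
  qed auto
  also have "sin (2 * pi * (real_of_int k * real L)) = 0"
    using sin_int_2pin[of "k * int L"] by (simp add: mult_ac)
  then have "?G (real L) - ?G (- real L) = 0"
    by simp
  finally show ?thesis .
qed

lemma measure_torus [simp]: "measure lborel torus = 1"
  by (simp add: torus_def)

lemma indicator_torus [simp]: "integrable lborel (indicator torus :: real \<Rightarrow> real)"
    "(LINT x|lborel. indicator torus x) = (1 :: real)"
  by (auto simp: torus_def)

text \<open>Phase mixing as orthogonality. On the torus times [-L, L) with integer L, the product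
  formula splits a product of two waves into a difference frequency in v alone, which integrates to
  0 unless n = m, and a sum frequency containing 2 x, which always integrates to 0.\<close>

lemma oscillation_tendsto_0:
  assumes \<phi>: "\<phi> \<in> Cc_phase" and u: "u \<in> borel_measurable borel" "\<And>v. \<bar>u v\<bar> \<le> B"
  shows "(\<lambda>n. pairing \<phi> (\<lambda>(x, v). u v * cos (2 * pi * (x + real n * v)))) \<longlonglongrightarrow> 0"
proof -
  from \<phi> obtain R where c: "continuous_on UNIV \<phi>" and R: "\<And>x v. \<bar>v\<bar> > R \<Longrightarrow> \<phi> (x, v) = 0"
    by (auto simp: Cc_phase_def)
  obtain C where C: "0 \<le> C" "\<And>x v. x \<in> torus \<Longrightarrow> \<bar>\<phi> (x, v)\<bar> \<le> C"
    using Cc_phase_bounded[OF \<phi>] by blast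
  \<comment> \<open>The successor makes |R| < L strict, so \<phi> vanishes off the half-open window,
    its right end included.\<close>
  define L where "L = Suc (nat \<lceil>\<bar>R\<bar>\<rceil>)"
  have L: "\<bar>R\<bar> < real L" "0 < L" unfolding L_def by linarith+
  define A where "A = torus \<times> {- real L..<real L}"
  have A [measurable]: "A \<in> sets borel" unfolding A_def by (intro borel_Times) auto
  let ?M = "restrict_space lborel A"
  define e where "e n z = cos (2 * pi * (fst z + real n * snd z))" for n and z :: "real \<times> real"
  have \<phi>_meas [measurable]: "\<phi> \<in> borel_measurable borel"
    by (rule borel_measurable_continuous_onI[OF c])
  have e_cont: "continuous_on UNIV (e n)" for n
    unfolding e_def by (intro continuous_intros)
  have e_meas [measurable]: "e n \<in> borel_measurable borel" for n
    by (rule borel_measurable_continuous_onI[OF e_cont])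
  have snd_meas [measurable]: "(snd :: real \<times> real \<Rightarrow> real) \<in> borel_measurable borel"
    by (intro borel_measurable_continuous_onI continuous_intros)
  have u_meas [measurable]: "(\<lambda>z :: real \<times> real. u (snd z)) \<in> borel_measurable borel"
    using u(1) snd_meas by measurable
  have restr: "(LINT z|?M. h z) = (LINT z|lborel. indicator A z * h z)" for h :: "real \<times> real \<Rightarrow> real"
    by (subst integral_restrict_space) auto
  have interval: "integrable lborel (\<lambda>v. indicator {- real L..<real L} v * cos (2 * pi * (real_of_int k * v)) :: real)" for k
    by (rule Bochner_Integration.integrable_bound[of _ "indicator {- real L..<real L} :: real \<Rightarrow> real"])
      (auto simp: indicator_def)
  have "(\<lambda>n. LINT z|?M. (\<phi> z * u (snd z)) * e n z) \<longlonglongrightarrow> 0"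
  proof (rule bessel_tendsto_0)
    have "emeasure lborel A = emeasure lborel torus * emeasure lborel {- real L..<real L}"
      unfolding A_def lborel_prod[symmetric] by (rule lborel.emeasure_pair_measure_Times) auto
    then have fin: "emeasure lborel A < \<infinity>" by (auto simp: torus_def ennreal_mult_less_top)
    then show "finite_measure ?M"
      by (intro finite_measureI) (auto simp: emeasure_restrict_space space_restrict_space)
    show "(\<lambda>z. \<phi> z * u (snd z)) \<in> borel_measurable ?M" "e n \<in> borel_measurable ?M" for n
      by (auto intro!: measurable_restrict_space1 borel_measurable_times)
    show "\<bar>\<phi> z * u (snd z)\<bar> \<le> C * B" if "z \<in> space ?M" for z
      using that C(2)[of "fst z" "snd z"] u(2)[of "snd z"] C(1)
      by (auto simp: A_def space_restrict_space abs_mult intro!: mult_mono)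
    show "\<bar>e n z\<bar> \<le> 1" for n z by (simp add: e_def)
    \<comment> \<open>The squared norm is half the measure 2 L of the window.\<close>
    show "0 < real L" using L by simp
    fix n m
    define k where "k = int n - int m"
    let ?f = "\<lambda>z. (indicator torus (fst z) :: real) * (indicator {- real L..<real L} (snd z) * cos (2 * pi * (real_of_int k * snd z)))"
    let ?g = "\<lambda>z. (indicator A z :: real) * cos (2 * pi * (2 * fst z + real (n + m) * snd z))"
    have f_int: "integrable lborel ?f"
      by (rule integrable_pair_mult[OF _ interval]) simp
    have gm: "(\<lambda>z :: real \<times> real. cos (2 * pi * (2 * fst z + real (n + m) * snd z))) \<in> borel_measurable borel"
      by (intro borel_measurable_continuous_onI continuous_intros)
    have "integrable lborel (indicator A :: real \<times> real \<Rightarrow> real)"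
      using fin by (intro integrable_real_indicator) auto
    then have g_int: "integrable lborel ?g"
      by (rule Bochner_Integration.integrable_bound) (use gm in \<open>auto simp: indicator_def\<close>)
    have g0: "(LINT z|lborel. ?g z) = 0"
    proof (rule integral_pair_eq_0_snd)
      fix v :: real
      have "(LINT x|lborel. indicator {- real L..<real L} v * (indicator torus x * cos (2 * pi * (real_of_int 2 * x + real (n + m) * v)))) = 0"
        by (subst integral_mult_right_zero, subst integral_torus_cos) auto
      then show "(LINT x|lborel. ?g (x, v)) = 0"
        by (simp add: A_def indicator_times mult_ac)
    qed
    have "(LINT z|?M. e n z * e m z) = (LINT z|lborel. (1 / 2) * ?f z + (1 / 2) * ?g z)"
      unfolding restr
    proof (intro Bochner_Integration.integral_cong refl)
      fix z :: "real \<times> real"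
      have eq: "2 * pi * (fst z + real n * snd z) - 2 * pi * (fst z + real m * snd z) = 2 * pi * (real_of_int k * snd z)"
        "2 * pi * (fst z + real n * snd z) + 2 * pi * (fst z + real m * snd z) = 2 * pi * (2 * fst z + real (n + m) * snd z)"
        by (auto simp: k_def algebra_simps)
      have "e n z * e m z = (cos (2 * pi * (real_of_int k * snd z)) + cos (2 * pi * (2 * fst z + real (n + m) * snd z))) / 2"
        unfolding e_def cos_times_cos eq ..
      then show "indicator A z * (e n z * e m z) = (1 / 2) * ?f z + (1 / 2) * ?g z"
        by (cases z) (auto simp: A_def indicator_def add_divide_distrib)
    qed
    also have "\<dots> = (1 / 2) * (LINT z|lborel. ?f z)"
      using f_int g_int g0 by simp
    also have "(LINT z|lborel. ?f z) = (LINT v|lborel. indicator {- real L..<real L} v * cos (2 * pi * (real_of_int k * v)))"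
      by (subst integral_pair_mult[OF _ interval]) auto
    also have "\<dots> = (if n = m then 2 * real L else 0)"
      using integral_interval_cos[of k L] by (auto simp: k_def)
    finally show "(LINT z|?M. e n z * e m z) = (if n = m then real L else 0)"
      by (auto split: if_splits)
  qed
  moreover have "(LINT z|?M. (\<phi> z * u (snd z)) * e n z) = pairing \<phi> (\<lambda>(x, v). u v * cos (2 * pi * (x + real n * v)))" for n
    unfolding restr pairing_def set_lebesgue_integral_def
  proof (intro Bochner_Integration.integral_cong refl)
    fix z :: "real \<times> real"
    show "indicator A z * (\<phi> z * u (snd z) * e n z)
        = indicat_real (torus \<times> UNIV) z *\<^sub>R (\<phi> z * (case z of (x, v) \<Rightarrow> u v * cos (2 * pi * (x + real n * v))))"
    proof (cases "snd z \<in> {- real L..<real L}")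
      case False
      then have "R < \<bar>snd z\<bar>" using L by auto
      then have "\<phi> z = 0" using R[of "snd z" "fst z"] by simp
      then show ?thesis by simp
    qed (cases z, simp add: A_def e_def indicator_def)
  qed
  ultimately show ?thesis by simp
qed

text \<open>Open sets arise from generating sets by finite intersections and unions, and eventual
  membership survives both; for a generating set it amounts to convergence of a single
  pairing.\<close>

lemma weak_topology_tendsto:
  assumes g: "\<And>n. g n \<in> phase_L1" and "openin weak_topology S" "g' \<in> S"
    and lim: "\<And>\<phi>. \<phi> \<in> Cc_phase \<Longrightarrow> (\<lambda>n. pairing \<phi> (g n)) \<longlonglongrightarrow> pairing \<phi> g'"
  shows "\<forall>\<^sub>F n in sequentially. g n \<in> S"
proof -
  have "generate_topology_on {{g \<in> phase_L1. pairing \<phi> g \<in> W} |\<phi> W. \<phi> \<in> Cc_phase \<and> open W} S"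
    using assms(2) by (simp add: weak_topology_def openin_topology_generated_by_iff)
  then show ?thesis using assms(3)
  proof induction
    case (Int a b)
    then show ?case by (auto intro: eventually_conj)
  next
    case (UN K)
    then obtain k where "k \<in> K" "g' \<in> k" by blast
    with UN.IH have "\<forall>\<^sub>F n in sequentially. g n \<in> k" by blast
    then show ?case by (rule eventually_mono) (use \<open>k \<in> K\<close> in blast)
  next
    case (Basis s)
    then obtain \<phi> W where s: "s = {g \<in> phase_L1. pairing \<phi> g \<in> W}" and \<phi>: "\<phi> \<in> Cc_phase" "open W"
      by blast
    have "\<forall>\<^sub>F n in sequentially. pairing \<phi> (g n) \<in> W"
      using topological_tendstoD[OF lim[OF \<phi>(1)] \<phi>(2)] Basis s by auto
    then show ?case by (simp add: s g)
  qed simp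
qed

text \<open>The difference of the wave and u (1 + cos) is |\<kappa> - u| plus the real part of
  \<kappa> - u times a unimodular factor, hence at most 2 |\<kappa> - u|. Beyond R the test function
  vanishes, so the mass that \<kappa> carries there never enters.\<close>

lemma wave_approximation:
  assumes \<phi>: "\<phi> \<in> Cc_phase" and C: "0 \<le> C" "\<And>x v. x \<in> torus \<Longrightarrow> \<bar>\<phi> (x, v)\<bar> \<le> C"
    and R: "\<And>x v. \<bar>v\<bar> > R \<Longrightarrow> \<phi> (x, v) = 0"
    and u: "integrable lborel u" "\<And>v. 0 \<le> u v" and \<kappa>: "integrable lborel \<kappa>" and T: "0 < T"
  shows "\<bar>pairing \<phi> (wave (\<lambda>v. u v + cmod (\<kappa> v - of_real (u v))) \<kappa> T t)
      - pairing \<phi> (\<lambda>(x, v). u v) - pairing \<phi> (\<lambda>(x, v). u v * cos (2 * pi * (x + (T - t) * v)))\<bar>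
    \<le> 2 * C * (LINT v|lborel. indicator {- R..R} v * cmod (\<kappa> v - of_real (u v)))"
proof -
  let ?F = "\<lambda>v. u v + cmod (\<kappa> v - of_real (u v))"
  let ?d = "\<lambda>v. cmod (\<kappa> v - of_real (u v))"
  have d: "integrable lborel ?d"
    by (intro integrable_norm Bochner_Integration.integrable_diff integrable_of_real u \<kappa>)
  have F: "integrable lborel ?F"
    by (intro Bochner_Integration.integrable_add u d)
  have d_ind: "integrable lborel (\<lambda>v. indicator {- R..R} v * ?d v)"
    using integrable_mult_indicator[OF _ d, of "{- R..R}"] by simp
  note [measurable] = F_meas[OF u(1) \<kappa> T] \<kappa>_meas[OF F \<kappa> T]
  have \<phi>_meas: "\<phi> \<in> borel_measurable borel"
    using \<phi> by (auto simp: Cc_phase_def intro: borel_measurable_continuous_onI)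
  have int: "integrable lborel (\<lambda>z. indicat_real (torus \<times> UNIV) z *\<^sub>R (\<phi> z * h z))"
    if h: "h \<in> borel_measurable borel" and bd: "\<And>x v. \<bar>h (x, v)\<bar> \<le> \<bar>?F v\<bar> + cmod (\<kappa> v)" for h
    unfolding set_integrable_def[symmetric]
  proof (rule integrable_dominated_xv[OF F \<kappa> T, where K = C])
    show "\<bar>\<phi> (x, v) * h (x, v)\<bar> \<le> C * (\<bar>?F v\<bar> + cmod (\<kappa> v))" if "x \<in> torus" for x v
      unfolding abs_mult using C bd that by (intro mult_mono) auto
  qed (use h \<phi>_meas in measurable)
  have m1: "(\<lambda>(x, v). u v) \<in> borel_measurable (borel :: (real \<times> real) measure)"
    "(\<lambda>(x, v). u v * cos (2 * pi * (x + (T - t) * v))) \<in> borel_measurable (borel :: (real \<times> real) measure)"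
    unfolding borel_prod[symmetric] by measurable
  note i1 = int[OF wave_meas[OF F \<kappa> T] wave_bound, of t]
  have i2: "integrable lborel (\<lambda>z. indicat_real (torus \<times> UNIV) z *\<^sub>R (\<phi> z * (case z of (x, v) \<Rightarrow> u v)))"
    by (rule int[OF m1(1)]) (use u(2) in \<open>simp add: add_nonneg_nonneg\<close>)
  have i3: "integrable lborel (\<lambda>z. indicat_real (torus \<times> UNIV) z *\<^sub>R (\<phi> z * (case z of (x, v) \<Rightarrow> u v * cos (2 * pi * (x + (T - t) * v)))))"
  proof (rule int[OF m1(2)])
    fix x v
    have "\<bar>u v * cos (2 * pi * (x + (T - t) * v))\<bar> \<le> \<bar>u v\<bar> * 1"
      unfolding abs_mult by (intro mult_left_mono) auto
    then show "\<bar>case (x, v) of (x, v) \<Rightarrow> u v * cos (2 * pi * (x + (T - t) * v))\<bar> \<le> \<bar>?F v\<bar> + cmod (\<kappa> v)"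
      using u(2)[of v] norm_ge_zero[of "\<kappa> v - of_real (u v)"] norm_ge_zero[of "\<kappa> v"] unfolding prod.case by linarith
  qed
  have "pairing \<phi> (wave ?F \<kappa> T t) - pairing \<phi> (\<lambda>(x, v). u v) - pairing \<phi> (\<lambda>(x, v). u v * cos (2 * pi * (x + (T - t) * v)))
    = (LINT z|lborel. indicat_real (torus \<times> UNIV) z *\<^sub>R (\<phi> z * wave ?F \<kappa> T t z)
        - indicat_real (torus \<times> UNIV) z *\<^sub>R (\<phi> z * (case z of (x, v) \<Rightarrow> u v))
        - indicat_real (torus \<times> UNIV) z *\<^sub>R (\<phi> z * (case z of (x, v) \<Rightarrow> u v * cos (2 * pi * (x + (T - t) * v)))))"
    (is "_ = (LINT z|lborel. ?h z)")
    unfolding pairing_def set_lebesgue_integral_def using i1 i2 i3 by simp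
  moreover have "\<bar>LINT z|lborel. ?h z\<bar> \<le> (LINT z|lborel. indicator torus (fst z) * (2 * C * (indicator {- R..R} (snd z) * ?d (snd z))))"
  proof (rule order_trans[OF integral_abs_bound integral_mono'])
    show "integrable lborel (\<lambda>z. indicat_real torus (fst z) * (2 * C * (indicator {- R..R} (snd z) * ?d (snd z))))"
      by (intro integrable_pair_mult[where g = "\<lambda>v. 2 * C * (indicator {- R..R} v * ?d v)"] integrable_mult_right d_ind) auto
    fix z :: "real \<times> real"
    obtain x v where z: "z = (x, v)" by (cases z)
    let ?\<theta> = "2 * pi * (x + (T - t) * v)"
    show "\<bar>?h z\<bar> \<le> indicator torus (fst z) * (2 * C * (indicator {- R..R} (snd z) * ?d (snd z)))"
    proof (cases "x \<in> torus \<and> \<bar>v\<bar> \<le> R")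
      case True
      have "wave ?F \<kappa> T t (x, v) - u v - u v * cos ?\<theta> = ?d v + Re ((\<kappa> v - of_real (u v)) * cis ?\<theta>)"
        by (simp add: wave_def algebra_simps)
      moreover have "\<bar>Re ((\<kappa> v - of_real (u v)) * cis ?\<theta>)\<bar> \<le> ?d v"
        using abs_Re_le_cmod[of "(\<kappa> v - of_real (u v)) * cis ?\<theta>"] by (simp only: norm_mult norm_cis mult_1_right)
      ultimately have "\<bar>wave ?F \<kappa> T t (x, v) - u v - u v * cos ?\<theta>\<bar> \<le> 2 * ?d v"
        by linarith
      then have "\<bar>\<phi> (x, v) * (wave ?F \<kappa> T t (x, v) - u v - u v * cos ?\<theta>)\<bar> \<le> C * (2 * ?d v)"
        unfolding abs_mult using C True by (intro mult_mono) auto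
      then show ?thesis using True by (auto simp: z indicator_def algebra_simps abs_le_iff)
    next
      case False
      then have "?h z = 0" using R[of v x] by (auto simp: z indicator_def)
      then show ?thesis using C by (simp add: z)
    qed
  qed (use C in auto)
  moreover have "(LINT z|lborel. indicator torus (fst z) * (2 * C * (indicator {- R..R} (snd z) * ?d (snd z))))
      = 1 * (2 * C * (LINT v|lborel. indicator {- R..R} v * ?d v))"
    by (subst integral_pair_mult[where g = "\<lambda>v. 2 * C * (indicator {- R..R} v * ?d v)"])
      (auto intro!: integrable_mult_right d_ind)
  ultimately show ?thesis by (simp add: mult.assoc)
qed

subsection \<open>Positivity of the mass of a stationary solution\<close>

text \<open>
  The class of functions \<open>bump p k\<close> is closed under differentiation, whence their smoothness.
\<close>

definition bump :: "real poly \<Rightarrow> nat \<Rightarrow> real \<Rightarrow> real" where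
  "bump p k t = (if \<bar>t\<bar> < 1 then poly p t / (1 - t\<^sup>2) ^ k * exp (- 1 / (1 - t\<^sup>2)) else 0)"

text \<open>A single term of the exponential series bounds exp (1 / s) from below.\<close>

lemma exp_minus_inverse_le:
  fixes s :: real
  assumes "0 < s"
  shows "exp (- 1 / s) \<le> fact n * s ^ n"
proof -
  have "(1 / s) ^ n / fact n \<le> exp (1 / s)"
  proof -
    have "(\<Sum>i\<in>{n}. (1 / s) ^ i /\<^sub>R fact i) \<le> (\<Sum>i. (1 / s) ^ i /\<^sub>R fact i)"
      by (rule sum_le_suminf) (use assms summable_exp_generic[of "1 / s"] in auto)
    then show ?thesis by (simp add: exp_def divide_inverse mult.commute)
  qed
  then show ?thesis
    using assms by (simp add: exp_minus power_divide field_simps)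
qed

text \<open>The exponential beats every power of 1 - y^2. Quadratic smallness near 1 and -1 is what
  yields derivative 0 at the two points where the definition switches.\<close>

lemma bump_quadratic:
  obtains K where "\<And>t y. \<bar>t\<bar> = 1 \<Longrightarrow> \<bar>bump p k y\<bar> \<le> K * (y - t)\<^sup>2"
proof -
  have "bounded (poly p ` {-1..1})"
    by (intro compact_imp_bounded compact_continuous_image continuous_intros) auto
  then obtain C where C: "\<And>t. t \<in> {-1..1} \<Longrightarrow> \<bar>poly p t\<bar> \<le> C"
    unfolding bounded_iff real_norm_def by blast
  have "\<bar>bump p k y\<bar> \<le> (4 * C * fact (k + 2)) * (y - t)\<^sup>2" if t: "\<bar>t\<bar> = 1" for t y
  proof (cases "\<bar>y\<bar> < 1")
    case True
    define s where "s = 1 - y\<^sup>2"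
    have y2: "y\<^sup>2 < 1" using True by (simp add: abs_square_less_1)
    have s: "0 < s" using y2 by (simp add: s_def)
    \<comment> \<open>As t^2 = 1, the difference 1 - y^2 factors as (1 - t y) (1 + t y), where |1 -
      t y| = |y - t| and the other factor is at most 2.\<close>
    have "\<bar>s\<bar> \<le> \<bar>2 * (y - t)\<bar>"
    proof -
      have "s = \<bar>1 - t * y\<bar> * \<bar>1 + t * y\<bar>"
        using t True y2 abs_less_iff[of y 1] by (auto simp: s_def abs_mult[symmetric] power2_eq_square algebra_simps abs_if split: if_splits)
      also have "\<dots> \<le> \<bar>y - t\<bar> * 2"
        using t True by (intro mult_mono) (auto simp: abs_if split: if_splits)
      finally show ?thesis using s unfolding abs_mult by simp
    qed
    then have "s\<^sup>2 \<le> (2 * (y - t))\<^sup>2"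
      by (simp only: abs_le_square_iff)
    then have s2: "s\<^sup>2 \<le> 4 * (y - t)\<^sup>2"
      unfolding power_mult_distrib by simp
    \<comment> \<open>The exponent k + 2 pays for the division by s^k and leaves s^2.\<close>
    have "exp (- 1 / s) / s ^ k \<le> fact (k + 2) * s\<^sup>2"
      using exp_minus_inverse_le[OF s, of "k + 2"] s by (simp add: field_simps power_add power2_eq_square)
    also have "\<dots> \<le> fact (k + 2) * (4 * (y - t)\<^sup>2)"
      using s2 by (intro mult_left_mono) auto
    finally have e: "exp (- 1 / s) / s ^ k \<le> fact (k + 2) * (4 * (y - t)\<^sup>2)" .
    have "\<bar>bump p k y\<bar> = \<bar>poly p y\<bar> * (exp (- 1 / s) / s ^ k)"
      using True s by (simp add: bump_def s_def[symmetric] abs_mult)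
    also have "\<dots> \<le> C * (fact (k + 2) * (4 * (y - t)\<^sup>2))"
    proof (intro mult_mono e)
      show "\<bar>poly p y\<bar> \<le> C" using True by (intro C) auto
      then show "0 \<le> C" by linarith
    qed (use s in auto)
    finally show ?thesis by (simp only: mult_ac)
  next
    case False
    have "0 \<le> C" using C[of 0] by simp
    then show ?thesis using False by (simp add: bump_def)
  qed
  then show ?thesis by (rule that)
qed

lemma bump_derivative:
  obtains p' k' where "\<And>t. (bump p k has_real_derivative bump p' k' t) (at t)"
proof -
  define q :: "real poly" where "q = [:1, 0, -1:]"
  have q: "poly q t = 1 - t\<^sup>2" for t
    by (simp add: q_def power2_eq_square)
  \<comment> \<open>Quotient and chain rule over the common denominator (1 - t^2)^(k + 2): the
    logarithmic derivative of the power is 2 k t / (1 - t^2), that of the exponential -2 t / (1 -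
    t^2)^2.\<close>
  define p' where "p' = pderiv p * q ^ 2 + smult (2 * real k) ([:0, 1:] * p * q) - smult 2 ([:0, 1:] * p)"
  have p': "poly p' t = poly (pderiv p) t * (1 - t\<^sup>2)\<^sup>2 + 2 * real k * t * poly p t * (1 - t\<^sup>2) - 2 * t * poly p t" for t
    by (simp add: p'_def q algebra_simps)
  have "(bump p k has_real_derivative bump p' (k + 2) t) (at t)" for t
  proof -
    consider "\<bar>t\<bar> < 1" | "\<bar>t\<bar> > 1" | "\<bar>t\<bar> = 1" by linarith
    then show ?thesis
    proof cases
      case 1
      then have t2: "1 - t\<^sup>2 > 0" by (simp add: abs_square_less_1)
      define s where "s = 1 - t\<^sup>2"
      have s: "s > 0" using t2 by (simp add: s_def)
      have ds: "((\<lambda>t. 1 - t\<^sup>2) has_real_derivative - 2 * t) (at t)"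
        by (auto intro!: derivative_eq_intros)
      have dk: "((\<lambda>t. (1 - t\<^sup>2) ^ k) has_real_derivative real k * s ^ (k - 1) * (- 2 * t)) (at t)"
        using DERIV_power[OF ds, of k] by (simp add: s_def mult_ac)
      have de: "((\<lambda>t. exp (- 1 / (1 - t\<^sup>2))) has_real_derivative exp (- 1 / s) * (- 2 * t / s\<^sup>2)) (at t)"
        using s by (auto intro!: derivative_eq_intros simp: s_def power2_eq_square)
      have dp: "((\<lambda>t. poly p t / (1 - t\<^sup>2) ^ k) has_real_derivative
          (poly (pderiv p) t * s ^ k - poly p t * (real k * s ^ (k - 1) * (- 2 * t))) / (s ^ k * s ^ k)) (at t)"
        using DERIV_divide[OF poly_DERIV dk] s by (simp add: s_def)
      have "((\<lambda>t. poly p t / (1 - t\<^sup>2) ^ k * exp (- 1 / (1 - t\<^sup>2))) has_real_derivative bump p' (k + 2) t) (at t)"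
      proof (rule DERIV_cong[OF DERIV_mult[OF dp de]])
        have k: "real k * s ^ (k - 1) = real k * s ^ k / s"
          using s by (cases k) auto
        show "(poly (pderiv p) t * s ^ k - poly p t * (real k * s ^ (k - 1) * (- 2 * t))) / (s ^ k * s ^ k) * exp (- 1 / (1 - t\<^sup>2))
          + exp (- 1 / s) * (- 2 * t / s\<^sup>2) * (poly p t / (1 - t\<^sup>2) ^ k) = bump p' (k + 2) t"
          unfolding k bump_def p' s_def[symmetric] using 1 s
          by (simp add: field_simps power_add power2_eq_square)
      qed
      then show ?thesis
        by (rule has_field_derivative_transform_within_open[where S = "{-1<..<1}"])
          (use 1 in \<open>auto simp: bump_def\<close>)
    next
      case 2
      have "((\<lambda>_. 0) has_real_derivative 0) (at t)" by simp
      then have "(bump p k has_real_derivative 0) (at t)"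
        by (rule has_field_derivative_transform_within_open[where S = "- {-1..1}"])
          (use 2 in \<open>auto simp: bump_def\<close>)
      then show ?thesis using 2 by (simp add: bump_def)
    next
      case 3
      obtain K where K: "\<And>t y. \<bar>t\<bar> = 1 \<Longrightarrow> \<bar>bump p k y\<bar> \<le> K * (y - t)\<^sup>2"
        using bump_quadratic[of p k] by metis
      have z: "bump p k t = 0" "bump p' (k + 2) t = 0" using 3 by (auto simp: bump_def)
      have "((\<lambda>y. (bump p k y - bump p k t) / (y - t)) \<longlongrightarrow> 0) (at t)"
      proof (rule Lim_null_comparison)
        show "\<forall>\<^sub>F y in at t. norm ((bump p k y - bump p k t) / (y - t)) \<le> K * \<bar>y - t\<bar>"
        proof (rule eventually_at_topological[THEN iffD2], intro exI conjI ballI impI)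
          fix y assume "y \<noteq> t"
          then show "norm ((bump p k y - bump p k t) / (y - t)) \<le> K * \<bar>y - t\<bar>"
            using K[OF 3, of y] z by (simp add: field_simps power2_eq_square abs_mult[symmetric])
        qed (rule open_UNIV, simp)
        show "((\<lambda>y. K * \<bar>y - t\<bar>) \<longlongrightarrow> 0) (at t)"
          by (auto intro!: tendsto_eq_intros)
      qed
      then show ?thesis by (simp only: has_field_derivative_iff z(2))
    qed
  qed
  then show ?thesis by (rule that)
qed

text \<open>By coinduction: a directional derivative introduces only the constant factor
  \<open>fst h\<close>, which the polynomial absorbs. The function depends on time alone, hence is
  trivially periodic in x.\<close>

lemma smooth_bump: "smooth (\<lambda>z :: real \<times> real. bump p k (fst z - c))"
proof -
  let ?X = "\<lambda>f :: real \<times> real \<Rightarrow> real. \<exists>p k. f = (\<lambda>z. bump p k (fst z - c))"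
  show ?thesis
  proof (rule smooth.coinduct[where X = ?X])
    show "?X (\<lambda>z. bump p k (fst z - c))" by blast
    fix f assume "?X f"
    then obtain p k where f: "f = (\<lambda>z. bump p k (fst z - c))" by blast
    obtain p' k' where d: "\<And>t. (bump p k has_real_derivative bump p' k' t) (at t)"
      using bump_derivative[of p k] by metis
    define D where "D z h = bump p' k' (fst z - c) * fst h" for z h :: "real \<times> real"
    have "(f has_derivative D z) (at z)" for z
    proof -
      have "((\<lambda>z :: real \<times> real. fst z - c) has_derivative fst) (at z)"
        by (auto intro!: derivative_eq_intros)
      from has_derivative_compose[OF this d[unfolded has_field_derivative_def]]
      show ?thesis by (simp add: f D_def[abs_def])
    qed
    moreover have "(\<lambda>z. D z h) = (\<lambda>z. bump (smult (fst h) p') k' (fst z - c))" for h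
      by (auto simp: D_def bump_def)
    then have "?X (\<lambda>z. D z h)" for h by blast
    ultimately show "\<exists>\<phi> D. f = \<phi> \<and> (\<forall>x. (\<phi> has_derivative D x) (at x)) \<and>
        (\<forall>h. ?X (\<lambda>x. D x h) \<or> smooth (\<lambda>x. D x h))"
      by blast
  qed
qed

text \<open>Weak continuity of the constant curve places its value in the underlying set of the
  topology, which lies in \<open>phase_L1\<close>.\<close>

lemma stationary_phase_L1:
  assumes "vpme_stationary g"
  shows "g \<in> phase_L1"
proof -
  have "continuous_map (top_of_set {0..1}) weak_topology (\<lambda>t :: real. g)"
    using assms by (auto simp: vpme_stationary_def vpme_weak_solution_def)
  from continuous_map_image_subset_topspace[OF this]
  have "\<forall>t\<in>topspace (top_of_set {0..1::real}). g \<in> topspace weak_topology"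
    unfolding image_subset_iff .
  from bspec[OF this, of 0] have "g \<in> topspace weak_topology" by simp
  then show ?thesis
    by (auto simp: weak_topology_def)
qed

text \<open>A test function of t alone has zero x-derivatives. With zero density the Poisson
  equation would then make the integral of exp U against it vanish, contradicting exp U > 0. This
  excludes \<mu> = 0 in particular.\<close>

lemma stationary_mass_nonzero:
  assumes "vpme_stationary (\<lambda>(x, v). \<mu> v)"
  shows "(LINT v|lborel. \<mu> v) \<noteq> 0"
proof
  assume zero: "(LINT v|lborel. \<mu> v) = 0"
  let ?S = "{0<..<4} \<times> torus"
  \<comment> \<open>Centred at time 2, the bump lives on [1, 3], well inside the time interval (0,
    4).\<close>
  define b where "b = (\<lambda>z :: real \<times> real. bump 1 0 (fst z - 2))"
  obtain U E where "poisson_weak 4 (density (\<lambda>t. \<lambda>(x, v). \<mu> v)) U E"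
    using assms by (auto simp: vpme_stationary_def vpme_weak_solution_def dest!: spec[of _ 4])
  then have U: "set_integrable lborel ?S (\<lambda>(t, x). exp (U t x))"
    and eq: "\<And>\<phi>. \<phi> \<in> test_tx 4 \<Longrightarrow>
      (LINT (t, x):?S|lborel. U t x * deriv (deriv (\<lambda>y. \<phi> (t, y))) x) =
      (LINT (t, x):?S|lborel. (exp (U t x) - density (\<lambda>t. \<lambda>(x, v). \<mu> v) t x) * \<phi> (t, x))"
    by (auto simp: poisson_weak_def)
  have b_sm: "smooth b" unfolding b_def by (rule smooth_bump)
  have b_meas [measurable]: "b \<in> borel_measurable borel"
    by (rule borel_measurable_continuous_onI[OF smooth_continuous[OF b_sm]])
  have b01: "0 \<le> b z" "b z \<le> 1" for z
    by (auto simp: b_def bump_def abs_square_less_1 intro: less_imp_le)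
  have b_pos: "0 < b (t, x)" if "1 < t" "t < 3" for t x
    using that by (auto simp: b_def bump_def)
  have "\<exists>a c. 0 < a \<and> c < 4 \<and> (\<forall>t x. b (t, x) \<noteq> 0 \<longrightarrow> a \<le> t \<and> t \<le> c)"
    by (rule exI[of _ 1], rule exI[of _ 3]) (auto simp: b_def bump_def)
  then have "b \<in> test_tx 4"
    unfolding test_tx_def using b_sm by (simp add: b_def)
  from eq[OF this] have "(LINT (t, x):?S|lborel. exp (U t x) * b (t, x)) = 0"
    using zero by (simp add: density_def b_def set_lebesgue_integral_def case_prod_unfold)
  then have int0: "(LINT z|lborel. indicator ?S z * exp (U (fst z) (snd z)) * b z) = 0"
    by (simp add: set_lebesgue_integral_def case_prod_unfold mult.assoc)
  have int: "integrable lborel (\<lambda>z. indicator ?S z * exp (U (fst z) (snd z)) * b z)"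
  proof (rule Bochner_Integration.integrable_bound)
    show *: "integrable lborel (\<lambda>z. indicator ?S z * exp (U (fst z) (snd z)))"
      using U by (simp add: set_integrable_def case_prod_unfold)
    show "(\<lambda>z. indicator ?S z * exp (U (fst z) (snd z)) * b z) \<in> borel_measurable lborel"
      using borel_measurable_integrable[OF *] by measurable
    show "AE z in lborel. norm (indicator ?S z * exp (U (fst z) (snd z)) * b z)
        \<le> norm (indicator ?S z * exp (U (fst z) (snd z)))"
      using b01 by (auto simp: abs_mult intro!: AE_I2 mult_left_le)
  qed
  have "AE z in lborel. indicator ?S z * exp (U (fst z) (snd z)) * b z = 0"
    using integral_nonneg_eq_0_iff_AE[OF int] int0 b01 by simp
  then have "AE z in lborel. z \<notin> {1<..<3 :: real} \<times> torus"
  proof eventually_elim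
    case (elim z)
    then show ?case using b_pos[of "fst z" "snd z"] by (cases z) (auto simp: indicator_def)
  qed
  then have "emeasure lborel ({1<..<3 :: real} \<times> torus) = 0"
    by (subst (asm) AE_iff_measurable[of "{1<..<3 :: real} \<times> torus"]) (auto intro!: borel_Times)
  moreover have "emeasure lborel ({1<..<3 :: real} \<times> torus) = emeasure lborel {1<..<3 :: real} * emeasure lborel torus"
    unfolding lborel_prod[symmetric] by (rule lborel.emeasure_pair_measure_Times) auto
  ultimately show False
    by (simp add: torus_def)
qed

subsection \<open>Instability\<close>

lemma torus_cos_squared: "(LINT x|lborel. indicator torus x * (cos (2 * pi * x))\<^sup>2) = 1 / 2"
proof -
  have i: "integrable lborel (\<lambda>x. indicator torus x * cos (2 * pi * (real_of_int 2 * x + 0)) :: real)"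
    by (rule Bochner_Integration.integrable_bound[OF indicator_torus(1)])
      (auto simp: indicator_def)
  have "(LINT x|lborel. indicator torus x * (cos (2 * pi * x))\<^sup>2)
      = (LINT x|lborel. (1 / 2) * indicator torus x + (1 / 2) * (indicator torus x * cos (2 * pi * (real_of_int 2 * x + 0))))"
  proof (intro Bochner_Integration.integral_cong refl)
    fix x :: real
    show "indicator torus x * (cos (2 * pi * x))\<^sup>2
        = (1 / 2) * indicator torus x + (1 / 2) * (indicator torus x * cos (2 * pi * (real_of_int 2 * x + 0)))"
      using cos_double_cos[of "2 * pi * x"] by (auto simp: indicator_def mult_ac add_divide_distrib diff_divide_distrib)
  qed
  also have "\<dots> = 1 / 2"
    using i integral_torus_cos[of 2 0] indicator_torus by (subst Bochner_Integration.integral_add) auto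
  finally show ?thesis .
qed

theorem proposition4p1:
  fixes \<mu> :: "real \<Rightarrow> real" and a a\<^sub>2 :: real
  assumes "vpme_stationary (\<lambda>(x, v). \<mu> v)"
    and "a > 0" and "a\<^sub>2 > 0"
    and "a\<^sup>2 \<ge> (112 * a\<^sub>2 + 3) * (4 * exp 12 + 1)"
    and "\<And>\<eta>. cmod (fourier \<mu> \<eta>) \<le> exp (-12) / 4 * exp (- a * \<bar>\<eta>\<bar>)"
    and "\<And>v. \<bar>\<mu> v\<bar> \<le> a\<^sub>2 / (2 * (1 + v ^ 4))"
    and "\<And>v. \<mu> v \<ge> 0"
  shows "vpme_weakly_unstable (\<lambda>(x, v). \<mu> v)"
proof -
  let ?g = "\<lambda>(x :: real, v). \<mu> v"
  note stat = assms(1) and decay = assms(6) and nonneg = assms(7)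
  have g_L1: "?g \<in> phase_L1" by (rule stationary_phase_L1[OF stat])
  \<comment> \<open>Restrict the measurable function on phase space to the slice x = 0, which lies
    in \<open>torus\<close>.\<close>
  have \<mu>_meas [measurable]: "\<mu> \<in> borel_measurable borel"
  proof -
    have "(\<lambda>z. indicat_real (torus \<times> UNIV) z *\<^sub>R (case z of (x, v) \<Rightarrow> \<mu> v)) \<in> borel_measurable borel"
      using g_L1 unfolding phase_L1_def set_integrable_def by (auto dest: borel_measurable_integrable)
    from measurable_compose[OF _ this, of "Pair 0" borel]
    have "(\<lambda>v. indicat_real (torus \<times> UNIV) (0, v) *\<^sub>R \<mu> v) \<in> borel_measurable borel"
      by (simp add: borel_measurable_continuous_onI continuous_on_Pair)
    then show ?thesis by (simp add: torus_def indicator_def)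
  qed
  \<comment> \<open>A Lorentzian majorant of known integral; the comparison of denominators follows
    from (v^2 - 1/4)^2 \<ge> 0.\<close>
  have \<mu>_le: "\<mu> v \<le> a\<^sub>2 * inverse (1 + v\<^sup>2)" for v
  proof -
    have "1 + v\<^sup>2 \<le> 2 * (1 + v ^ 4)"
    proof -
      have "(v\<^sup>2 - 1 / 4) * (v\<^sup>2 - 1 / 4) = v ^ 4 - v\<^sup>2 / 2 + 1 / 16"
        by (simp add: power2_eq_square power4_eq_xxxx algebra_simps)
      with zero_le_square[of "v\<^sup>2 - 1 / 4"] have "0 \<le> v ^ 4 - v\<^sup>2 / 2 + 1 / 16"
        by metis
      then show ?thesis by simp
    qed
    then have "a\<^sub>2 / (2 * (1 + v ^ 4)) \<le> a\<^sub>2 / (1 + v\<^sup>2)"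
      using assms(3) by (intro divide_left_mono) (auto intro!: mult_pos_pos add_pos_nonneg)
    then show ?thesis using decay[of v] nonneg[of v] by (simp add: divide_inverse)
  qed
  have \<mu>_int: "integrable lborel \<mu>"
  proof (rule Bochner_Integration.integrable_bound)
    show "integrable lborel (\<lambda>v. a\<^sub>2 * inverse (1 + v\<^sup>2))"
      using integrable_inverse_1_plus_square by (simp add: set_integrable_def)
    show "AE v in lborel. norm (\<mu> v) \<le> norm (a\<^sub>2 * inverse (1 + v\<^sup>2))"
      using \<mu>_le nonneg by (auto intro!: AE_I2 intro: order_trans[OF _ abs_ge_self])
  qed simp
  have \<mu>_bd: "\<mu> v \<le> a\<^sub>2" for v
  proof -
    have "a\<^sub>2 * inverse (1 + v\<^sup>2) \<le> a\<^sub>2 * 1"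
      using assms(3) by (intro mult_left_mono) (auto simp: inverse_le_1_iff)
    then show ?thesis using \<mu>_le[of v] by simp
  qed
  have mass: "0 < (LINT v|lborel. \<mu> v)"
  proof -
    have "0 \<le> (LINT v|lborel. \<mu> v)"
      by (rule integral_nonneg_AE) (simp add: nonneg)
    with stationary_mass_nonzero[OF stat] show ?thesis by simp
  qed

  \<comment> \<open>Continuous cutoffs, 1 on [-n, n] and 0 beyond n + 1; the observable cos (2 \<pi>
    x) alone is not compactly supported in v.\<close>
  define \<psi> where "\<psi> n v = max 0 (min 1 (real n + 1 - \<bar>v\<bar>))" for n and v :: real
  have \<psi>: "0 \<le> \<psi> n v" "\<psi> n v \<le> 1" for n v by (auto simp: \<psi>_def)
  have \<psi>_cont: "continuous_on UNIV (\<psi> n)" for n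
    unfolding \<psi>_def by (intro continuous_intros)
  have \<psi>_meas [measurable]: "\<psi> n \<in> borel_measurable borel" for n
    by (rule borel_measurable_continuous_onI[OF \<psi>_cont])
  have \<psi>\<mu>: "integrable lborel (\<lambda>v. \<psi> n v * \<mu> v)" for n
    by (rule Bochner_Integration.integrable_bound[OF \<mu>_int])
      (auto simp: abs_mult \<psi> intro!: AE_I2 mult_left_le_one_le)
  have "(\<lambda>n. LINT v|lborel. \<psi> n v * \<mu> v) \<longlonglongrightarrow> (LINT v|lborel. \<mu> v)"
  proof (rule integral_dominated_convergence[OF _ _ \<mu>_int])
    show "AE v in lborel. (\<lambda>n. \<psi> n v * \<mu> v) \<longlonglongrightarrow> \<mu> v"
    proof (intro AE_I2 tendsto_eventually)
      fix v :: real
      show "\<forall>\<^sub>F n in sequentially. \<psi> n v * \<mu> v = \<mu> v"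
        using eventually_ge_at_top[of "nat \<lceil>\<bar>v\<bar>\<rceil>"]
      proof eventually_elim
        case (elim n)
        then have "\<bar>v\<bar> \<le> real n" by linarith
        then show ?case by (simp add: \<psi>_def)
      qed
    qed
    show "AE v in lborel. norm (\<psi> n v * \<mu> v) \<le> \<mu> v" for n
      using \<psi> nonneg by (auto simp: abs_mult intro!: AE_I2 mult_left_le_one_le)
  qed simp_all
  then have "\<forall>\<^sub>F n in sequentially. 0 < (LINT v|lborel. \<psi> n v * \<mu> v)"
    using mass by (rule order_tendstoD(1))
  then obtain k where k: "0 < (LINT v|lborel. \<psi> k v * \<mu> v)"
    by (auto simp: eventually_sequentially)
  \<comment> \<open>The mass of \<mu> seen through the cutoff. The cut-off cosine defined next pairs
    to 0 with \<mu> and to m / 2 with \<mu> cos (2 \<pi> x), since cos^2 has mean 1/2.\<close>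
  define m where "m = (LINT v|lborel. \<psi> k v * \<mu> v)"
  define \<phi>\<^sub>0 where "\<phi>\<^sub>0 = (\<lambda>(x, v). cos (2 * pi * x) * \<psi> k v)"
  have \<phi>\<^sub>0: "\<phi>\<^sub>0 \<in> Cc_phase"
  proof -
    have "continuous_on UNIV \<phi>\<^sub>0"
      unfolding \<phi>\<^sub>0_def case_prod_unfold
      by (intro continuous_intros continuous_on_compose2[OF \<psi>_cont]) auto
    moreover have "cos (2 * pi * (x + 1)) = cos (2 * pi * x)" for x :: real
      using cos_periodic[of "2 * pi * x"] by (simp add: algebra_simps)
    moreover have "\<forall>x v. real k + 1 < \<bar>v\<bar> \<longrightarrow> \<phi>\<^sub>0 (x, v) = 0"
      by (auto simp: \<phi>\<^sub>0_def \<psi>_def)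
    ultimately show ?thesis
      by (auto simp: Cc_phase_def \<phi>\<^sub>0_def intro!: exI[of _ "real k + 1"])
  qed
  have \<phi>\<^sub>0_\<mu>: "pairing \<phi>\<^sub>0 ?g = 0"
  proof -
    have c: "integrable lborel (\<lambda>x. indicator torus x * cos (2 * pi * x) :: real)"
      by (rule Bochner_Integration.integrable_bound[OF indicator_torus(1)]) (auto simp: indicator_def)
    have "pairing \<phi>\<^sub>0 ?g = (LINT z|lborel. (indicator torus (fst z) * cos (2 * pi * fst z)) * (\<psi> k (snd z) * \<mu> (snd z)))"
      unfolding pairing_def set_lebesgue_integral_def
      by (intro Bochner_Integration.integral_cong refl) (auto simp: \<phi>\<^sub>0_def indicator_def)
    also have "\<dots> = 0"
      using integral_pair_mult[OF c \<psi>\<mu>[of k]] integral_torus_cos[of 1 0] by simp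
    finally show ?thesis .
  qed
  have \<phi>\<^sub>0_cos: "pairing \<phi>\<^sub>0 (\<lambda>(x, v). \<mu> v * cos (2 * pi * x)) = m / 2"
  proof -
    have c: "integrable lborel (\<lambda>x. indicator torus x * (cos (2 * pi * x))\<^sup>2 :: real)"
      by (rule Bochner_Integration.integrable_bound[OF indicator_torus(1)])
        (auto simp: indicator_def abs_square_le_1)
    have "pairing \<phi>\<^sub>0 (\<lambda>(x, v). \<mu> v * cos (2 * pi * x))
        = (LINT z|lborel. (indicator torus (fst z) * (cos (2 * pi * fst z))\<^sup>2) * (\<psi> k (snd z) * \<mu> (snd z)))"
      unfolding pairing_def set_lebesgue_integral_def
      by (intro Bochner_Integration.integral_cong refl)
        (auto simp: \<phi>\<^sub>0_def indicator_def power2_eq_square)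
    also have "\<dots> = m / 2"
      using integral_pair_mult[OF c \<psi>\<mu>[of k]] torus_cos_squared by (simp add: m_def)
    finally show ?thesis .
  qed

  \<comment> \<open>One index governs the window [-n, n] and the accuracy 1 / (n + 1), so the
    support of each fixed test function eventually lies in the window.\<close>
  have "\<exists>\<kappa> :: real \<Rightarrow> complex. integrable lborel \<kappa> \<and>
      (\<forall>s\<ge>0. (LINT v|lborel. \<kappa> v * cis (s * v)) = 0) \<and>
      (LINT v|lborel. indicator {- real n..real n} v * cmod (\<kappa> v - of_real (\<mu> v))) < inverse (real (Suc n))" for n
    using one_sided_approximation[OF \<mu>_meas nonneg \<mu>_bd, of "inverse (real (Suc n))" "real n"] by auto
  then obtain \<kappa> :: "nat \<Rightarrow> real \<Rightarrow> complex" where \<kappa>_int: "\<And>n. integrable lborel (\<kappa> n)"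
    and gap: "\<And>n s. 0 \<le> s \<Longrightarrow> (LINT v|lborel. \<kappa> n v * cis (s * v)) = 0"
    and close: "\<And>n. (LINT v|lborel. indicator {- real n..real n} v * cmod (\<kappa> n v - of_real (\<mu> v))) < inverse (real (Suc n))"
    by metis
  define F where "F n = (\<lambda>v. \<mu> v + cmod (\<kappa> n v - of_real (\<mu> v)))" for n
  define f where "f n = wave (F n) (\<kappa> n) (real (Suc n))" for n
  have d_int: "integrable lborel (\<lambda>v. cmod (\<kappa> n v - of_real (\<mu> v)))" for n
    by (intro integrable_norm Bochner_Integration.integrable_diff integrable_of_real \<mu>_int \<kappa>_int)
  have F_int: "integrable lborel (F n)" for n
    unfolding F_def by (intro Bochner_Integration.integrable_add \<mu>_int d_int)
  have F_mass: "0 < (LINT v|lborel. F n v)" for n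
  proof -
    have "(LINT v|lborel. \<mu> v) \<le> (LINT v|lborel. F n v)"
      by (rule integral_mono[OF \<mu>_int F_int]) (simp add: F_def)
    with mass show ?thesis by linarith
  qed
  have sol: "vpme_weak_solution (real (Suc n)) (f n)" for n
    unfolding f_def by (rule wave_weak_solution[OF F_int \<kappa>_int _ gap F_mass]) auto
  \<comment> \<open>By the triangle inequality F \<ge> |\<kappa>|, and the oscillating part is at
    most |\<kappa>| in absolute value.\<close>
  have f_nonneg: "0 \<le> f n t z" for n t z
  proof (cases z)
    case (Pair x v)
    have "cmod (\<kappa> n v) \<le> F n v"
      using norm_triangle_sub[of "\<kappa> n v" "of_real (\<mu> v)"] nonneg[of v] by (simp add: F_def)
    then show ?thesis
      using abs_Re_le_cmod[of "\<kappa> n v * cis (2 * pi * (x + (real (Suc n) - t) * v))"]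
      unfolding f_def wave_def Pair prod.case norm_mult norm_cis by linarith
  qed
  have f_L1: "f n t \<in> phase_L1" for n t
    unfolding f_def by (rule wave_phase_L1[OF F_int \<kappa>_int]) simp

  \<comment> \<open>The error bound does not depend on time, so the sampling times are arbitrary;
    they are taken to be 0 and the final time.\<close>
  have approx: "(\<lambda>n. pairing \<phi> (f n (\<tau> n)) - pairing \<phi> ?g
      - pairing \<phi> (\<lambda>(x, v). \<mu> v * cos (2 * pi * (x + (real (Suc n) - \<tau> n) * v)))) \<longlonglongrightarrow> 0"
    if \<phi>: "\<phi> \<in> Cc_phase" for \<phi> and \<tau> :: "nat \<Rightarrow> real"
  proof -
    from \<phi> obtain R where R: "\<And>x v. \<bar>v\<bar> > R \<Longrightarrow> \<phi> (x, v) = 0"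
      by (auto simp: Cc_phase_def)
    obtain C where C: "0 \<le> C" "\<And>x v. x \<in> torus \<Longrightarrow> \<bar>\<phi> (x, v)\<bar> \<le> C"
      using Cc_phase_bounded[OF \<phi>] by blast
    show ?thesis
    proof (rule Lim_null_comparison)
      show "\<forall>\<^sub>F n in sequentially. norm (pairing \<phi> (f n (\<tau> n)) - pairing \<phi> ?g
          - pairing \<phi> (\<lambda>(x, v). \<mu> v * cos (2 * pi * (x + (real (Suc n) - \<tau> n) * v))))
        \<le> 2 * C * inverse (real (Suc n))"
        using eventually_ge_at_top[of "nat \<lceil>R\<rceil>"]
      proof eventually_elim
        case (elim n)
        then have "R \<le> real n" by linarith
        then have "\<phi> (x, v) = 0" if "\<bar>v\<bar> > real n" for x v
          using R that by force
        from wave_approximation[OF \<phi> C this \<mu>_int nonneg \<kappa>_int, where T = "real (Suc n)" and t = "\<tau> n"]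
        have "norm (pairing \<phi> (f n (\<tau> n)) - pairing \<phi> ?g
            - pairing \<phi> (\<lambda>(x, v). \<mu> v * cos (2 * pi * (x + (real (Suc n) - \<tau> n) * v))))
          \<le> 2 * C * (LINT v|lborel. indicator {- real n..real n} v * cmod (\<kappa> n v - of_real (\<mu> v)))"
          by (simp add: f_def F_def)
        also have "\<dots> \<le> 2 * C * inverse (real (Suc n))"
          using C close[of n] by (intro mult_left_mono) auto
        finally show ?case .
      qed
      show "(\<lambda>n. 2 * C * inverse (real (Suc n))) \<longlonglongrightarrow> 0"
        by (rule tendsto_mult_right_zero[OF LIMSEQ_inverse_real_of_nat])
    qed
  qed
  have initial: "(\<lambda>n. pairing \<phi> (f n 0)) \<longlonglongrightarrow> pairing \<phi> ?g" if \<phi>: "\<phi> \<in> Cc_phase" for \<phi>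
  proof -
    have "(\<lambda>n. pairing \<phi> (\<lambda>(x, v). \<mu> v * cos (2 * pi * (x + real n * v)))) \<longlonglongrightarrow> 0"
      by (rule oscillation_tendsto_0[OF \<phi> \<mu>_meas]) (use \<mu>_bd nonneg in simp)
    from LIMSEQ_Suc[OF this]
    have "(\<lambda>n. pairing \<phi> (\<lambda>(x, v). \<mu> v * cos (2 * pi * (x + (real (Suc n) - 0) * v)))) \<longlonglongrightarrow> 0"
      by simp
    from tendsto_add[OF tendsto_add[OF approx[OF \<phi>, of "\<lambda>_. 0"] this] tendsto_const[of "pairing \<phi> ?g"]]
    show ?thesis by simp
  qed
  have final: "(\<lambda>n. pairing \<phi>\<^sub>0 (f n (real (Suc n)))) \<longlonglongrightarrow> m / 2"
    using tendsto_add[OF approx[OF \<phi>\<^sub>0, of "\<lambda>n. real (Suc n)"] tendsto_const[of "m / 2"]]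
    by (simp add: \<phi>\<^sub>0_\<mu> \<phi>\<^sub>0_cos)

  \<comment> \<open>The threshold m / 4 separates the value 0 at \<mu> from the limit m / 2 at the
    final times.\<close>
  define N where "N = {g \<in> phase_L1. pairing \<phi>\<^sub>0 g \<in> {..<m / 4}}"
  have "openin weak_topology N"
    unfolding weak_topology_def N_def using \<phi>\<^sub>0
    by (intro topology_generated_by_Basis) (blast intro: open_lessThan)
  moreover have "?g \<in> N"
    using g_L1 \<phi>\<^sub>0_\<mu> k by (simp add: N_def m_def)
  ultimately have N: "weak_neighbourhood ?g N"
    by (auto simp: weak_neighbourhood_def)
  show ?thesis
    unfolding vpme_weakly_unstable_def
  proof (rule conjI[OF stat], rule exI[of _ N], rule conjI[OF N], intro allI impI)
    fix N' assume "weak_neighbourhood ?g N'"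
    then obtain S where S: "openin weak_topology S" "?g \<in> S" "S \<subseteq> N'"
      by (auto simp: weak_neighbourhood_def)
    have "\<forall>\<^sub>F n in sequentially. f n 0 \<in> S"
      by (rule weak_topology_tendsto[OF f_L1 S(1,2) initial])
    moreover have "\<forall>\<^sub>F n in sequentially. m / 4 < pairing \<phi>\<^sub>0 (f n (real (Suc n)))"
      using k by (intro order_tendstoD(1)[OF final]) (simp add: m_def)
    ultimately have "\<forall>\<^sub>F n in sequentially. f n 0 \<in> S \<and> m / 4 < pairing \<phi>\<^sub>0 (f n (real (Suc n)))"
      by (rule eventually_conj)
    then obtain n where n: "f n 0 \<in> S" "m / 4 < pairing \<phi>\<^sub>0 (f n (real (Suc n)))"
      by (auto simp: eventually_sequentially)
    have "f n (real (Suc n)) \<notin> N" using n(2) by (simp add: N_def)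
    with n(1) S(3) sol[of n] f_nonneg
    show "\<exists>T f. T > 0 \<and> vpme_weak_solution T f \<and> (\<forall>t\<in>{0..T}. \<forall>z. 0 \<le> f t z) \<and> f 0 \<in> N' \<and> f T \<notin> N"
      by (intro exI[of _ "real (Suc n)"] exI[of _ "f n"]) auto
  qed
qed

end
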